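(* Let $\mu(y)=a\,y\ln y$ with $a\in[7,8]$, let $\varphi$ be the Jacob's ladder corresponding to $\mu$, and for $T\ge T_0[\varphi]$, $U>0$ let $\alpha(T,U)$ be the angle of the chord of the curve $y=\frac12\varphi(T)$ that binds the points $[T,\frac12\varphi(T)]$ and $[T+U,\frac12\varphi(T+U)]$, i.e. $\tan[\alpha(T,U)]=\frac{\varphi(T+U)-\varphi(T)}{2U}$. Then $$\int_T^{T+U} Z^2(t)\,dt=\left\{1+\mathcal{O}\left(\frac{\ln\ln T}{\ln T}\right)\right\}U\ln T\,\tan[\alpha(T,U)],\qquad U\in\left(0,\frac{T}{\ln T}\right],\ T\ge T_0[\varphi].$$
   Context: $Z(t)=e^{i\vartheta(t)}\zeta\left(\frac12+it\right)$ with $\vartheta(t)=-\frac t2\ln\pi+\operatorname{Im}\ln\Gamma\left(\frac14+i\frac t2\right)$, where $\zeta$ is the Riemann zeta-function; thus $Z^2(t)=|\zeta(\frac12+it)|^2$. For a function $\mu$ with $\mu(y)\ge 7y\ln y$, the Jacob's ladder $\varphi(T)=\varphi_\mu(T)$ is the (increasing, tending to infinity) solution $x(T)=\varphi(T)$ of the nonlinear integral equation $$\int_0^{\mu[x(T)]}Z^2(t)e^{-\frac{2}{x(T)}t}\,dt=\int_0^T Z^2(t)\,dt .$$ $T_0[\varphi]$ denotes a sufficiently large constant depending on $\varphi$. *)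

theory Defs
  imports "HOL-Complex_Analysis.Complex_Analysis"
begin

text \<open>The Riemann zeta function as the analytic continuation of its Dirichlet series.  By the
  identity theorem the continuation is unique off the pole; the value at 1 is unspecified.\<close>

definition zeta :: "complex \<Rightarrow> complex" where
  "zeta = (SOME f. f holomorphic_on (- {1}) \<and>
     (\<forall>s. 1 < Re s \<longrightarrow> (\<lambda>n. of_nat (Suc n) powr (- s)) sums f s))"

text \<open>\<^const>\<open>ln_Gamma\<close> is the branch of the logarithm of Gamma that is holomorphic off the
  nonpositive real axis and real on the positive reals, not the principal logarithm of Gamma.\<close>

definition siegel_theta :: "real \<Rightarrow> real" where
  "siegel_theta t = - (t / 2) * ln pi + Im (ln_Gamma (Complex (1 / 4) (t / 2)))"

text \<open>The values of Hardy's function are real by the functional equation of zeta.  The function is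
  complex-valued here only for typing, and its square is written \<open>(cmod (hardy_Z t))\<^sup>2\<close>.\<close>

definition hardy_Z :: "real \<Rightarrow> complex" where
  "hardy_Z t = exp (\<i> * of_real (siegel_theta t)) * zeta (Complex (1 / 2) t)"

text \<open>The equation and the monotonicity are only required from some point on.  There, because
  \<open>\<phi>\<close> tends to infinity, the upper limit \<open>\<mu> (\<phi> T)\<close> is eventually positive.\<close>

definition jacobs_ladder :: "(real \<Rightarrow> real) \<Rightarrow> (real \<Rightarrow> real) \<Rightarrow> bool" where
  "jacobs_ladder \<mu> \<phi> \<longleftrightarrow>
     (\<forall>\<^sub>F y in at_top. 7 * y * ln y \<le> \<mu> y) \<and>
     filterlim \<phi> at_top at_top \<and>
     (\<exists>T\<^sub>1\<ge>0. strict_mono_on {T\<^sub>1..} \<phi> \<and>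
        (\<forall>T\<ge>T\<^sub>1. integral {0..\<mu> (\<phi> T)} (\<lambda>t. (cmod (hardy_Z t))\<^sup>2 * exp (- (2 / \<phi> T) * t)) =
                  integral {0..T} (\<lambda>t. (cmod (hardy_Z t))\<^sup>2)))"

text \<open>The angle with the horizontal axis of the chord of the curve \<open>y = \<phi> T / 2\<close> over
  \<open>[T, T + U]\<close>.\<close>

definition chord_angle :: "(real \<Rightarrow> real) \<Rightarrow> real \<Rightarrow> real \<Rightarrow> real" where
  "chord_angle \<phi> T U = arctan ((\<phi> (T + U) - \<phi> T) / (2 * U))"

end

theory Submission
  imports Defs "HOL-Real_Asymp.Real_Asymp"
begin

text \<open>
  Hardy's function has the modulus of zeta on the critical line, so the equation of the ladder says
  that \<open>\<Phi> (\<phi> T)\<close> is the integral of its squared modulus over \<open>[0, T]\<close>, where \<open>\<Phi> y\<close> is the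
  integral up to \<open>a * y * ln y\<close> with the weight \<open>exp (- 2 * t / y)\<close>.  Hence the integral over
  \<open>[T, T + U]\<close> is \<open>\<Phi> (\<phi> (T + U)) - \<Phi> (\<phi> T)\<close>, and by the mean value theorem this is
  \<open>\<phi> (T + U) - \<phi> T\<close> times \<open>\<Phi>' z\<close> for some \<open>z\<close> between \<open>\<phi> T\<close> and \<open>\<phi> (T + U)\<close>.  Everything
  comes down to \<open>2 * \<Phi>' z = ln T + O(ln (ln T))\<close>.

  Differentiation gives \<open>\<Phi>' y\<close> as \<open>2 / y\<^sup>2\<close> times the second moment of zeta with the weight
  \<open>t * exp (- 2 * t / y)\<close>, plus a boundary term that is bounded because the weight at the upper
  limit is \<open>y powr (- 2 * a)\<close>.  That moment is \<open>y\<^sup>2 * ln y / 4 + O(y\<^sup>2)\<close>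
  (\<open>weighted_second_moment\<close>), so \<open>\<Phi>' y = ln y / 2 + O(1)\<close> (\<open>smoothed_deriv_approx\<close>).  From this
  and the monotonicity of the integrals, \<open>\<phi> T\<close> equals \<open>T\<close> up to powers of \<open>ln T\<close>
  (\<open>ladder_log_bounds\<close>); this step alone produces the iterated logarithm in the error term.

  The moment is computed from Euler-Maclaurin summation: with \<open>N\<close> comparable to \<open>y\<close>, zeta on the
  critical line is the sum of \<open>n powr (- s)\<close> over \<open>n < N\<close>, a pole term, and \<open>s\<close> times a weighted average
  over \<open>u\<close> in \<open>[0, 1]\<close> of Dirichlet polynomials in \<open>n + u\<close> with \<open>n \<ge> N\<close>, up to a negligible
  error.  The diagonal of the first sum gives the main term (\<open>zsum_mean_square\<close>).  The square of the
  last part is \<open>O(y\<^sup>2)\<close> (\<open>block_mean_square\<close>), and so is its product with the first sum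
  (\<open>zsum_block_cross\<close>), since their frequencies are separated.  Both rest on the smoothness of the
  weight: the Laplace transform of \<open>t * exp (- c * t)\<close> decays quadratically, so that sums over pairs
  of frequencies converge absolutely (\<open>dpoly_mean_square\<close>, \<open>dpoly_cross\<close>).

  All this presupposes that the analytic continuation defining zeta exists, which is shown by
  extending it from half-plane to half-plane by Taylor expansion of the powers
  (\<open>zeta_continuation_halfplane\<close>).
\<close>

section \<open>Analytic continuation of zeta\<close>

lemma norm_Suc_powr: "cmod (of_nat (Suc n) powr z) = real (Suc n) powr Re z"
  using norm_powr_real_powr[of "of_real (real (Suc n))" z] by (simp del: of_nat_Suc)

text \<open>The falling factorial of \<open>z\<close> gives the coefficients of the derivatives of \<open>x powr z\<close>.\<close>

definition falling :: "complex \<Rightarrow> nat \<Rightarrow> complex" where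
  "falling z j = (\<Prod>i<j. z - of_nat i)"

lemma falling_0 [simp]: "falling z 0 = 1"
  and falling_Suc [simp]: "falling z (Suc j) = falling z j * (z - of_nat j)"
  by (simp_all add: falling_def)

lemma holomorphic_on_falling [holomorphic_intros]:
  "f holomorphic_on A \<Longrightarrow> (\<lambda>s. falling (f s) j) holomorphic_on A"
  unfolding falling_def by (intro holomorphic_intros)

text \<open>The error of the Taylor polynomial of degree \<open>J\<close> of \<open>x powr (1 - s)\<close> at
  \<open>x = n + 1\<close>, taken one unit further on.  Summed over \<open>n\<close> the powers themselves
  telescope, while each Taylor term produces a Dirichlet series at a shifted argument; this is the
  source of the continuation of zeta.\<close>

definition power_rem :: "nat \<Rightarrow> nat \<Rightarrow> complex \<Rightarrow> complex" where
  "power_rem J n s = of_nat (Suc (Suc n)) powr (1 - s) -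
     (\<Sum>i\<le>J. falling (1 - s) i * of_nat (Suc n) powr (1 - s - of_nat i) / fact i)"

text \<open>Taylor's theorem: the remainder is one power of \<open>n\<close> smaller than the last Taylor term, so
  raising \<open>J\<close> by one widens the half-plane on which the sum over \<open>n\<close> converges by one.\<close>

lemma norm_power_rem_le:
  assumes "0 \<le> Re s + real J"
  shows "cmod (power_rem J n s) \<le>
    cmod (falling (1 - s) (Suc J)) * real (Suc n) powr (- (Re s + real J))"
proof -
  let ?S = "closed_segment (of_nat (Suc n)) (of_nat (Suc (Suc n))) :: complex set"
  let ?f = "\<lambda>i x. falling (1 - s) i * x powr (1 - s - of_nat i)"
  let ?B = "cmod (falling (1 - s) (Suc J)) * real (Suc n) powr (- (Re s + real J))"
  have seg: "\<exists>r. x = of_real r \<and> real (Suc n) \<le> r" if "x \<in> ?S" for x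
  proof -
    have "x \<in> closed_segment (of_real (real (Suc n))) (of_real (real (Suc (Suc n))))"
      using that by (simp only: of_real_of_nat_eq)
    then have "x \<in> of_real ` closed_segment (real (Suc n)) (real (Suc (Suc n)))"
      by (simp only: closed_segment_of_real)
    then show ?thesis by (auto simp: closed_segment_eq_real_ivl)
  qed
  have "cmod (?f 0 (of_nat (Suc (Suc n))) -
     (\<Sum>i\<le>J. ?f i (of_nat (Suc n)) * (of_nat (Suc (Suc n)) - of_nat (Suc n)) ^ i / fact i))
     \<le> ?B * cmod (of_nat (Suc (Suc n)) - of_nat (Suc n)) ^ Suc J / fact J"
  proof (rule complex_Taylor[where S = ?S])
    fix i x assume x: "x \<in> ?S" "i \<le> J"
    then obtain r where r: "x = of_real r" "real (Suc n) \<le> r" using seg by blast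
    have "x \<notin> \<real>\<^sub>\<le>\<^sub>0" using r by (auto simp del: of_nat_Suc)
    then have "(?f i has_field_derivative
        falling (1 - s) i * ((1 - s - of_nat i) * x powr (1 - s - of_nat i - 1))) (at x)"
      by (intro DERIV_cmult has_field_derivative_powr)
    moreover have "1 - s - of_nat i - 1 = 1 - s - of_nat (Suc i)" by simp
    ultimately show "(?f i has_field_derivative ?f (Suc i) x) (at x within ?S)"
      by (simp only: falling_Suc mult.assoc has_field_derivative_at_within)
  next
    fix x assume x: "x \<in> ?S"
    then obtain r where r: "x = of_real r" "real (Suc n) \<le> r" using seg by blast
    have "cmod (x powr (1 - s - of_nat (Suc J))) = r powr (- (Re s + real J))"
      using r by (subst r(1), subst norm_powr_real_powr) auto
    also have "\<dots> \<le> real (Suc n) powr (- (Re s + real J))"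
      using r assms by (intro powr_mono2') auto
    finally show "cmod (?f (Suc J) x) \<le> ?B"
      unfolding norm_mult by (rule mult_left_mono) auto
  qed auto
  also have "?B * cmod (of_nat (Suc (Suc n)) - of_nat (Suc n)) ^ Suc J / fact J \<le> ?B"
  proof -
    have "?B / fact J \<le> ?B / 1" by (intro divide_left_mono) (auto simp: fact_ge_1)
    then show ?thesis by simp
  qed
  finally show ?thesis by (simp add: power_rem_def)
qed

lemma holomorphic_suminf:
  fixes f :: "nat \<Rightarrow> complex \<Rightarrow> complex"
  assumes S: "open S" and hol: "\<And>n. f n holomorphic_on S"
    and bd: "\<And>x. x \<in> S \<Longrightarrow> \<exists>d h. 0 < d \<and> summable h \<and> (\<forall>n. \<forall>y\<in>ball x d \<inter> S. cmod (f n y) \<le> h n)"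
  shows "(\<lambda>s. \<Sum>n. f n s) holomorphic_on S"
    and "\<And>s. s \<in> S \<Longrightarrow> (\<lambda>n. f n s) sums (\<Sum>n. f n s)"
proof -
  have "\<exists>g g'. \<forall>x\<in>S. (\<lambda>n. f n x) sums g x \<and> (\<lambda>n. deriv (f n) x) sums g' x \<and>
      (g has_field_derivative g' x) (at x)"
  proof (rule series_and_derivative_comparison_local[OF S])
    show "(f n has_field_derivative deriv (f n) x) (at x)" if "x \<in> S" for n x
      using holomorphic_derivI[OF hol S that] .
    show "\<exists>d h. 0 < d \<and> summable h \<and>
        (\<forall>\<^sub>F n in sequentially. \<forall>y\<in>ball x d \<inter> S. cmod (f n y) \<le> h n)" if x: "x \<in> S" for x
    proof -
      obtain d h where "0 < d" "summable h" "\<forall>n. \<forall>y\<in>ball x d \<inter> S. cmod (f n y) \<le> h n"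
        using bd[OF x] by blast
      then show ?thesis by (intro exI[of _ d] exI[of _ h]) auto
    qed
  qed
  then obtain g g' where g: "\<forall>x\<in>S. (\<lambda>n. f n x) sums g x \<and> (g has_field_derivative g' x) (at x)"
    by blast
  then show "(\<lambda>n. f n s) sums (\<Sum>n. f n s)" if "s \<in> S" for s
    using that by (auto simp: sums_iff)
  have "g holomorphic_on S"
    using g S by (auto simp: holomorphic_on_open)
  then show "(\<lambda>s. \<Sum>n. f n s) holomorphic_on S"
    by (rule holomorphic_transform) (use g in \<open>auto simp: sums_iff\<close>)
qed

lemma summable_Suc_powr:
  assumes "1 < \<sigma>" shows "summable (\<lambda>n. real (Suc n) powr - \<sigma>)"
  using assms by (subst summable_Suc_iff[where f="\<lambda>n. real n powr - \<sigma>"]) (simp add: summable_real_powr_iff)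

lemma power_rem_series:
  fixes J :: nat
  defines "H \<equiv> {s. 1 - real J < Re s}"
  shows "(\<lambda>s. \<Sum>n. power_rem J n s) holomorphic_on H"
    and "\<And>s. s \<in> H \<Longrightarrow> (\<lambda>n. power_rem J n s) sums (\<Sum>n. power_rem J n s)"
proof -
  have H: "open H" unfolding H_def by (rule open_halfspace_Re_gt)
  have hol: "power_rem J n holomorphic_on H" for n
    unfolding power_rem_def by (intro holomorphic_intros) (auto simp del: of_nat_Suc)
  have bd: "\<exists>d h. 0 < d \<and> summable h \<and> (\<forall>n. \<forall>y\<in>ball x d \<inter> H. cmod (power_rem J n y) \<le> h n)"
    if x: "x \<in> H" for x
  proof -
    \<comment> \<open>Half the distance to the boundary of the half-plane.\<close>
  define d where "d = (Re x - (1 - real J)) / 2"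
    have d: "d > 0" using x by (simp add: d_def H_def)
    define \<sigma> where "\<sigma> = 1 + d"
    have "compact ((\<lambda>s. falling (1 - s) (Suc J)) ` cball x d)"
      by (intro compact_continuous_image holomorphic_on_imp_continuous_on holomorphic_intros) auto
    then obtain M where M: "\<And>s. s \<in> cball x d \<Longrightarrow> cmod (falling (1 - s) (Suc J)) \<le> M"
      unfolding bounded_iff by (meson compact_imp_bounded bounded_iff imageI)
    have "summable (\<lambda>n. M * real (Suc n) powr - \<sigma>)"
      using d by (intro summable_mult summable_Suc_powr) (auto simp: \<sigma>_def)
    moreover have "cmod (power_rem J n y) \<le> M * real (Suc n) powr - \<sigma>" if y: "y \<in> ball x d \<inter> H" for n y
    proof -
      have "\<bar>Re x - Re y\<bar> \<le> d"
        using y abs_Re_le_cmod[of "x - y"] by (auto simp: dist_norm)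
      then have *: "\<sigma> \<le> Re y + real J" unfolding \<sigma>_def d_def by argo
      have "cmod (power_rem J n y) \<le> cmod (falling (1 - y) (Suc J)) * real (Suc n) powr - (Re y + real J)"
        using * d by (intro norm_power_rem_le) (auto simp: \<sigma>_def)
      also have "\<dots> \<le> M * real (Suc n) powr - \<sigma>"
        using M[of y] y * by (intro mult_mono powr_mono order.trans[OF norm_ge_zero M[of y]]) auto
      finally show ?thesis .
    qed
    ultimately show ?thesis using d by blast
  qed
  show "(\<lambda>s. \<Sum>n. power_rem J n s) holomorphic_on H"
    and "\<And>s. s \<in> H \<Longrightarrow> (\<lambda>n. power_rem J n s) sums (\<Sum>n. power_rem J n s)"
    using holomorphic_suminf[OF H hol bd] by blast+
qed

lemma summable_Dirichlet:
  assumes "1 < Re s" shows "summable (\<lambda>n. of_nat (Suc n) powr (- s) :: complex)"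
proof (rule summable_norm_cancel)
  have "cmod (of_nat (Suc n) powr (- s)) = real (Suc n) powr - Re s" for n
    by (simp only: norm_Suc_powr) simp
  then show "summable (\<lambda>n. cmod (of_nat (Suc n) powr (- s)))"
    using summable_Suc_powr[OF assms] by simp
qed

text \<open>The sum over \<open>n\<close> of \<open>(n + 2) powr (1 - s) - (n + 1) powr (1 - s)\<close> telescopes to
  \<open>- 1\<close>; expanding each difference by Taylor relates zeta at \<open>s\<close> to zeta at
  \<open>s + 1\<close>, \<open>s + 2\<close>, and so on.\<close>

lemma Dirichlet_recursion:
  assumes s: "1 < Re s"
  defines "D \<equiv> \<lambda>s. \<Sum>n. of_nat (Suc n) powr (- s) :: complex"
  shows "- 1 = (\<Sum>i = 1..J. falling (1 - s) i / fact i * D (s + of_nat i - 1)) + (\<Sum>n. power_rem J n s)"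
proof -
  let ?p = "\<lambda>n. of_nat (Suc n) powr (1 - s) :: complex"
  have "?p \<longlonglongrightarrow> 0"
  proof (rule tendsto_norm_zero_cancel)
    have "((\<lambda>n. real (Suc n) powr (1 - Re s)) \<longlonglongrightarrow> 0)"
      using s by real_asymp
    moreover have "cmod (?p n) = real (Suc n) powr (1 - Re s)" for n
      by (simp only: norm_Suc_powr) simp
    ultimately show "(\<lambda>n. cmod (?p n)) \<longlonglongrightarrow> 0" by simp
  qed
  from telescope_sums[OF this] have tel: "(\<lambda>n. ?p (Suc n) - ?p n) sums (- 1)" by simp
  have "?p (Suc n) - ?p n =
     (\<Sum>i = 1..J. falling (1 - s) i / fact i * of_nat (Suc n) powr (- (s + of_nat i - 1))) + power_rem J n s" for n
  proof -
    have "{..J} = insert 0 {1..J}" by auto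
    then show ?thesis unfolding power_rem_def
      by (simp add: algebra_simps)
  qed
  then have tel': "(\<lambda>n. (\<Sum>i = 1..J. falling (1 - s) i / fact i * of_nat (Suc n) powr (- (s + of_nat i - 1))) + power_rem J n s) sums (- 1)"
    using tel by simp
  have "(\<lambda>n. (\<Sum>i = 1..J. falling (1 - s) i / fact i * of_nat (Suc n) powr (- (s + of_nat i - 1))) + power_rem J n s) sums
     ((\<Sum>i = 1..J. falling (1 - s) i / fact i * D (s + of_nat i - 1)) + (\<Sum>n. power_rem J n s))"
    unfolding D_def
    by (intro sums_add sums_sum sums_mult summable_sums summable_Dirichlet power_rem_series(2)) (use s in auto)
  with tel' show ?thesis by (rule sums_unique2)
qed

text \<open>Induction moves the boundary of the half-plane one unit to the left.  The recursion expresses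
  zeta at \<open>s\<close> through its values further right, but these have poles at
  \<open>s = 0, -1, -2, \<dots>\<close>, cancelled by zeros of the falling factorials.  The induction therefore
  runs on \<open>g s = (s - 1) * zeta s\<close>, for which the cancellation has been carried out: the factor
  \<open>s + i - 2\<close> of the coefficient is absorbed into \<open>g (s + i - 1)\<close>.\<close>

lemma zeta_continuation_halfplane:
  "\<exists>g. g holomorphic_on {s. 1 - real m < Re s} \<and>
     (\<forall>s. 1 < Re s \<longrightarrow> g s = (s - 1) * (\<Sum>n. of_nat (Suc n) powr (- s)))"
proof (induction m)
  case 0
  let ?D = "\<lambda>s. \<Sum>n. of_nat (Suc n) powr (- s) :: complex"
  have H: "open {s. 1 < Re s}" by (rule open_halfspace_Re_gt)
  have "?D holomorphic_on {s. 1 < Re s}"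
  proof (rule holomorphic_suminf(1)[OF H])
    show "(\<lambda>s. of_nat (Suc n) powr (- s) :: complex) holomorphic_on {s. 1 < Re s}" for n
      by (intro holomorphic_intros) (auto simp del: of_nat_Suc)
    show "\<exists>d h. 0 < d \<and> summable h \<and>
      (\<forall>n. \<forall>y\<in>ball x d \<inter> {s. 1 < Re s}. cmod (of_nat (Suc n) powr (- y)) \<le> h n)"
      if x: "x \<in> {s. 1 < Re s}" for x
    proof (intro exI conjI allI ballI)
      show "0 < (Re x - 1) / 2" using x by simp
      show "summable (\<lambda>n. real (Suc n) powr - ((Re x + 1) / 2))"
        using x by (intro summable_Suc_powr) simp
      fix n y assume y: "y \<in> ball x ((Re x - 1) / 2) \<inter> {s. 1 < Re s}"
      have "\<bar>Re x - Re y\<bar> \<le> (Re x - 1) / 2"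
        using y abs_Re_le_cmod[of "x - y"] by (auto simp: dist_norm)
      then have "(Re x + 1) / 2 \<le> Re y" by argo
      moreover have "cmod (of_nat (Suc n) powr (- y)) = real (Suc n) powr - Re y"
        by (simp only: norm_Suc_powr) simp
      ultimately show "cmod (of_nat (Suc n) powr (- y)) \<le> real (Suc n) powr - ((Re x + 1) / 2)"
        by (auto intro!: powr_mono)
    qed
  qed
  then show ?case
    by (intro exI[of _ "\<lambda>s. (s - 1) * ?D s"]) (auto intro!: holomorphic_intros)
next
  case (Suc m)
  let ?D = "\<lambda>s. \<Sum>n. of_nat (Suc n) powr (- s) :: complex"
  let ?H = "{s. 1 - real (Suc m) < Re s}"
  obtain g where g: "g holomorphic_on {s. 1 - real m < Re s}"
    "\<And>s. 1 < Re s \<Longrightarrow> g s = (s - 1) * ?D s" using Suc by auto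
  define h where "h = (\<lambda>s. 1 - (\<Sum>i = 2..Suc m. falling (1 - s) (i - 1) / fact i * g (s + of_nat i - 1))
     + (\<Sum>n. power_rem (Suc m) n s))"
  have "h holomorphic_on ?H"
    unfolding h_def
  proof (intro holomorphic_intros power_rem_series(1)[of "Suc m"])
    fix i assume i: "i \<in> {2..Suc m}"
    have "(g \<circ> (\<lambda>s. s + of_nat i - 1)) holomorphic_on ?H"
      by (rule holomorphic_on_compose_gen[OF _ g(1)]) (use i in \<open>auto intro!: holomorphic_intros\<close>)
    then show "(\<lambda>s. g (s + of_nat i - 1)) holomorphic_on ?H" by (simp add: o_def)
  qed auto
  moreover have "h s = (s - 1) * ?D s" if s: "1 < Re s" for s
  proof -
    have "falling (1 - s) (i - 1) / fact i * g (s + of_nat i - 1) =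
       - (falling (1 - s) i / fact i * ?D (s + of_nat i - 1))" if i: "i \<in> {2..Suc m}" for i
    proof -
      obtain k where k: "i = Suc k" using i by (cases i) auto
      have g': "g (s + of_nat i - 1) = (s + of_nat k - 1) * ?D (s + of_nat i - 1)"
        using s i k by (subst g(2)) auto
      have f': "falling (1 - s) i = - (falling (1 - s) (i - 1) * (s + of_nat k - 1))"
        by (simp add: k algebra_simps)
      show ?thesis unfolding g' f' by simp
    qed
    then have "h s = 1 + (\<Sum>i = 2..Suc m. falling (1 - s) i / fact i * ?D (s + of_nat i - 1))
        + (\<Sum>n. power_rem (Suc m) n s)"
      unfolding h_def by (simp add: sum_negf)
    moreover have "(\<Sum>i = 1..Suc m. falling (1 - s) i / fact i * ?D (s + of_nat i - 1)) =
      (1 - s) * ?D s + (\<Sum>i = 2..Suc m. falling (1 - s) i / fact i * ?D (s + of_nat i - 1))"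
      by (subst sum.atLeast_Suc_atMost) (auto simp: numeral_2_eq_2)
    moreover have "hs = (s - 1) * D" if "hs = 1 + X + R" "Y = (1 - s) * D + X" "- 1 = Y + R"
      for hs X R Y D :: complex
      using that by algebra
    ultimately show ?thesis using Dirichlet_recursion[OF s, of "Suc m"] by blast
  qed
  ultimately show ?case by blast
qed

text \<open>The continuations to the half-planes agree on overlaps by the identity theorem and so glue to one
  function, which is what makes the choice in the definition of \<^const>\<open>zeta\<close> meaningful.\<close>

lemma zeta_continuation_exists:
  "\<exists>f. f holomorphic_on (- {1}) \<and>
     (\<forall>s. 1 < Re s \<longrightarrow> (\<lambda>n. of_nat (Suc n) powr (- s)) sums f s)"
proof -
  let ?D = "\<lambda>s. \<Sum>n. of_nat (Suc n) powr (- s) :: complex"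
  define H where "H = (\<lambda>m::nat. {s. 1 - real m < Re s})"
  obtain g where g: "\<And>m. g m holomorphic_on H m"
    "\<And>m s. 1 < Re s \<Longrightarrow> g m s = (s - 1) * ?D s"
    using zeta_continuation_halfplane unfolding H_def by metis
  have opH: "open (H m)" for m unfolding H_def by (rule open_halfspace_Re_gt)
  have conH: "connected (H m)" for m
    unfolding H_def by (intro convex_connected convex_halfspace_Re_gt)
  have eq: "g m s = g k s" if "m \<le> k" "s \<in> H m" for m k s
  proof (rule analytic_continuation_open[where s = "{s. 1 < Re s}" and s' = "H m"
      and f = "g m" and g = "g k"])
    show "{s. 1 < Re s} \<noteq> {}" by (auto intro!: exI[of _ "2 :: complex"])
    show "g k holomorphic_on H m"
      using g(1)[of k] by (rule holomorphic_on_subset) (use that in \<open>auto simp: H_def\<close>)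
  qed (use g that opH conH in \<open>auto simp: open_halfspace_Re_gt H_def\<close>)
  \<comment> \<open>Any index whose half-plane contains \<open>s\<close> would do.\<close>
  define i where "i = (\<lambda>s. nat \<lceil>2 - Re s\<rceil>)"
  have i: "s \<in> H (i s)" for s
    unfolding H_def i_def by simp linarith
  define f where "f = (\<lambda>s. g (i s) s / (s - 1))"
  have feq: "f s = g m s / (s - 1)" if "s \<in> H m" for s m
    using eq[of m "i s" s] eq[of "i s" m s] that i[of s] unfolding f_def
    by (metis linorder_linear)
  have "f holomorphic_on - {1}"
  proof (rule holomorphic_on_subset)
    show "f holomorphic_on (\<Union>m. H m - {1})"
    proof (rule holomorphic_on_UN_open)
      fix m
      have "(\<lambda>s. g m s / (s - 1)) holomorphic_on (H m - {1})"
        by (intro holomorphic_intros holomorphic_on_subset[OF g(1)]) auto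
      then show "f holomorphic_on H m - {1}"
        using feq by (subst holomorphic_cong[OF refl, of _ _ "\<lambda>s. g m s / (s - 1)"]) auto
      show "open (H m - {1})" using opH by auto
    qed
    show "- {1} \<subseteq> (\<Union>m. H m - {1})" using i by auto
  qed
  moreover have "(\<lambda>n. of_nat (Suc n) powr (- s)) sums f s" if "1 < Re s" for s
  proof -
    have "f s = ?D s" using that g(2)[OF that, of "i s"] by (auto simp: f_def)
    then show ?thesis using summable_sums[OF summable_Dirichlet[OF that]] by simp
  qed
  ultimately show ?thesis by blast
qed

lemma zeta_holomorphic: "zeta holomorphic_on - {1}"
  and zeta_sums: "1 < Re s \<Longrightarrow> (\<lambda>n. of_nat (Suc n) powr (- s)) sums zeta s"
  using someI_ex[OF zeta_continuation_exists] unfolding zeta_def by blast+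

text \<open>The first-order recursion already converges to the right of the imaginary axis, so the identity
  theorem carries it over to the critical line.\<close>

lemma zeta_eq_power_rem:
  assumes "0 < Re s" "s \<noteq> 1"
  shows "(s - 1) * zeta s = 1 + (\<Sum>n. power_rem 1 n s)"
proof (rule analytic_continuation_open[where s = "{s. 1 < Re s}" and s' = "{s. 0 < Re s} - {1}"
    and f = "\<lambda>s. (s - 1) * zeta s" and g = "\<lambda>s. 1 + (\<Sum>n. power_rem 1 n s)"])
  show "{s. 1 < Re s} \<noteq> {}" by (auto intro!: exI[of _ "2 :: complex"])
  show "connected ({s. 0 < Re s} - {1})"
    by (intro connected_open_delete open_halfspace_Re_gt convex_connected convex_halfspace_Re_gt) simp
  show "(\<lambda>s. (s - 1) * zeta s) holomorphic_on {s. 0 < Re s} - {1}"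
    by (intro holomorphic_intros holomorphic_on_subset[OF zeta_holomorphic]) auto
  show "(\<lambda>s. 1 + (\<Sum>n. power_rem 1 n s)) holomorphic_on {s. 0 < Re s} - {1}"
    by (intro holomorphic_intros holomorphic_on_subset[OF power_rem_series(1)[of 1]]) auto
  show "(z - 1) * zeta z = 1 + (\<Sum>n. power_rem 1 n z)" if "z \<in> {s. 1 < Re s}" for z
  proof -
    have z: "1 < Re z" using that by simp
    have "zeta z = (\<Sum>n. of_nat (Suc n) powr (- z))"
      using zeta_sums[OF z] by (simp add: sums_iff)
    then show ?thesis using Dirichlet_recursion[OF z, of 1] by (simp add: algebra_simps)
  qed
qed (use assms in \<open>auto simp: open_halfspace_Re_gt\<close>)

section \<open>Sums of powers\<close>

text \<open>All double sums below are reduced to sums of \<open>h powr (- (3/2))\<close> over a difference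
  \<open>h \<ge> 1\<close>: the exponent is large enough for convergence and small enough to leave room for
  interpolating between the two natural bounds of a kernel.\<close>

lemma powr_three_halves_telescope:
  fixes x :: real assumes "1 \<le> x"
  shows "x powr (- (3/2)) \<le> 4 * (x powr (- (1/2)) - (x + 1) powr (- (1/2)))"
proof -
  \<comment> \<open>With square roots as variables the claim becomes polynomial.\<close>
  define a b where "a = sqrt x" and "b = sqrt (x + 1)"
  have ab: "1 \<le> a" "a \<le> b" "a\<^sup>2 = x" "b\<^sup>2 = x + 1"
    using assms by (auto simp: a_def b_def)
  have "b\<^sup>2 \<le> (3/2 * a)\<^sup>2" using ab assms by (simp add: power_divide power_mult_distrib)
  then have b: "b \<le> 3/2 * a" by (rule power2_le_imp_le) (use ab in linarith)
  have "(b - a) * (b + a) = 1" using ab by (simp add: algebra_simps power2_eq_square)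
  moreover have "(b - a) * (b + a) \<le> (b - a) * (5/2 * a)"
    using b ab by (intro mult_left_mono) auto
  ultimately have *: "1 \<le> (b - a) * (5/2 * a)" by simp
  have "b * 1 \<le> b * ((b - a) * (5/2 * a))" using * ab by (intro mult_left_mono) auto
  also have "\<dots> \<le> (3/2 * a) * ((b - a) * (5/2 * a))"
    using b ab by (intro mult_right_mono mult_nonneg_nonneg) auto
  also have "\<dots> = 15/4 * (a\<^sup>2 * (b - a))" by (simp add: power2_eq_square)
  also have "\<dots> \<le> 4 * (a\<^sup>2 * (b - a))" using ab by (intro mult_right_mono) auto
  finally have "b \<le> 4 * (a\<^sup>2 * (b - a))" by simp
  then have "1 / (a * a\<^sup>2) \<le> 4 * (1 / a - 1 / b)"
  proof -
    have "4 * (1 / a - 1 / b) - 1 / (a * a\<^sup>2) = (4 * (a\<^sup>2 * (b - a)) - b) / (a * a\<^sup>2 * b)"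
      using ab(1,2) by (simp add: field_simps power2_eq_square)
    then show ?thesis using \<open>b \<le> 4 * (a\<^sup>2 * (b - a))\<close> ab
      by (smt (verit) divide_nonneg_pos zero_less_mult_iff zero_less_power)
  qed
  moreover have "x powr (- (3/2)) = 1 / (a * a\<^sup>2)"
  proof -
    have "x powr (3/2) = x powr (1/2 + 1)" by simp
    also have "\<dots> = a * x" using assms by (simp only: powr_add a_def) (simp add: powr_half_sqrt)
    finally show ?thesis using ab by (simp add: powr_minus field_simps)
  qed
  moreover have "x powr (- (1/2)) = 1 / a" "(x + 1) powr (- (1/2)) = 1 / b"
    using assms by (auto simp: powr_minus powr_half_sqrt a_def b_def field_simps)
  ultimately show ?thesis by simp
qed

lemma sum_powr_three_halves_le:
  fixes x :: real assumes "1 \<le> x + real K"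
  shows "(\<Sum>n = K..<L. (x + real n) powr (- (3/2))) \<le> 4 * (x + real K) powr (- (1/2))"
proof (cases "K \<le> L")
  case True
  have "(\<Sum>n = K..<L. (x + real n) powr (- (3/2))) \<le>
    (\<Sum>n = K..<L. 4 * ((x + real n) powr (- (1/2)) - (x + real (Suc n)) powr (- (1/2))))"
    using assms
    by (intro sum_mono order.trans[OF powr_three_halves_telescope]) (auto simp: add_ac)
  also have "\<dots> = 4 * ((x + real K) powr (- (1/2)) - (x + real L) powr (- (1/2)))"
    unfolding sum_distrib_left[symmetric]
    using True sum_Suc_diff'[of K L "\<lambda>n. - ((x + real n) powr (- (1/2)))"] by simp
  also have "\<dots> \<le> 4 * (x + real K) powr (- (1/2))" by simp
  finally show ?thesis .
qed auto

lemma sum_powr_half_le: "(\<Sum>n = 1..<N. real n powr (- (1/2))) \<le> 2 * sqrt (real N)"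
proof -
  have *: "real n powr (- (1/2)) \<le> 2 * (sqrt (real n) - sqrt (real n - 1))" if "1 \<le> n" for n
  proof -
    define a b where "a = sqrt (real n - 1)" and "b = sqrt (real n)"
    have ab: "0 \<le> a" "a \<le> b" "1 \<le> b" "a\<^sup>2 = real n - 1" "b\<^sup>2 = real n"
      using that by (auto simp: a_def b_def)
    have "(b - a) * (b + a) = 1" using ab by (simp add: algebra_simps power2_eq_square)
    moreover have "(b - a) * (b + a) \<le> (b - a) * (2 * b)" using ab by (intro mult_left_mono) auto
    ultimately have "1 / b \<le> 2 * (b - a)" using ab by (simp add: field_simps)
    moreover have "real n powr (- (1/2)) = 1 / b"
      using that by (simp add: powr_minus powr_half_sqrt b_def field_simps)
    ultimately show ?thesis by (simp add: a_def b_def)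
  qed
  have "(\<Sum>n = 1..<N. real n powr (- (1/2))) \<le> 2 * sqrt (real N - 1)" if "1 \<le> N" for N
    using that
  proof (induction N rule: dec_induct)
    case (step N)
    have "(\<Sum>n = 1..<Suc N. real n powr (- (1/2))) \<le> 2 * sqrt (real N - 1) + real N powr (- (1/2))"
      using step by simp
    also have "\<dots> \<le> 2 * sqrt (real (Suc N) - 1)" using *[of N] step by simp
    finally show ?case .
  qed auto
  from this[of N] show ?thesis
    by (cases "1 \<le> N") (auto intro: order.trans[OF _ mult_left_mono[OF real_sqrt_le_mono]])
qed

section \<open>Truncated Laplace transforms of monomials\<close>

text \<open>The upper limit \<open>T\<close> of integration lies so far beyond the scale \<open>y\<close> of the exponential
  weight that an integral up to \<open>T\<close> and the integral up to infinity differ negligibly.  The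
  polynomial in \<open>T / y\<close> is the one that integration by parts of \<open>t\<^sup>2 * exp (- t / y)\<close>
  produces at \<open>T\<close>.\<close>

definition cutoff :: "real \<Rightarrow> real \<Rightarrow> bool" where
  "cutoff y T \<longleftrightarrow> 1 \<le> y \<and> 0 \<le> T \<and> exp (- T / y) * (2 + 2 * (T / y) + (T / y)\<^sup>2) \<le> 1 / y"

definition laplace_moment :: "nat \<Rightarrow> real \<Rightarrow> complex \<Rightarrow> complex" where
  "laplace_moment k T z = integral {0..T} (\<lambda>t. of_real (t ^ k) * exp (- z * of_real t))"

lemma laplace_moment_1_eq:
  assumes "z \<noteq> 0" "0 \<le> T"
  shows "laplace_moment 1 T z = 1 / z\<^sup>2 - exp (- z * of_real T) * (1 + z * of_real T) / z\<^sup>2"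
proof -
  let ?F = "\<lambda>t. - (exp (- z * of_real t) * (1 + z * of_real t)) / z\<^sup>2"
  have "((\<lambda>t. of_real (t ^ 1) * exp (- z * of_real t)) has_integral (?F T - ?F 0)) {0..T}"
  proof (rule fundamental_theorem_of_calculus)
    fix t assume "t \<in> {0..T}"
    have "((\<lambda>w. - (exp (- z * w) * (1 + z * w)) / z\<^sup>2) has_field_derivative
       (of_real t * exp (- z * of_real t))) (at (of_real t))"
      using assms by (auto intro!: derivative_eq_intros simp: field_simps power2_eq_square)
    from has_vector_derivative_real_field[OF this]
    show "(?F has_vector_derivative of_real (t ^ 1) * exp (- z * of_real t)) (at t within {0..T})"
      by simp
  qed (use assms in auto)
  then show ?thesis unfolding laplace_moment_def by (simp add: integral_unique)
qed

lemma laplace_moment_2_eq: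
  assumes "z \<noteq> 0" "0 \<le> T"
  shows "laplace_moment 2 T z = 2 / z^3 -
     exp (- z * of_real T) * (2 + 2 * z * of_real T + z\<^sup>2 * (of_real T)\<^sup>2) / z^3"
proof -
  let ?F = "\<lambda>t. - (exp (- z * of_real t) * (2 + 2 * z * of_real t + z\<^sup>2 * (of_real t)\<^sup>2)) / z^3"
  have "((\<lambda>t. of_real (t ^ 2) * exp (- z * of_real t)) has_integral (?F T - ?F 0)) {0..T}"
  proof (rule fundamental_theorem_of_calculus)
    fix t assume "t \<in> {0..T}"
    have "((\<lambda>w. - (exp (- z * w) * (2 + 2 * z * w + z\<^sup>2 * w\<^sup>2)) / z^3) has_field_derivative
       (of_real (t\<^sup>2) * exp (- z * of_real t))) (at (of_real t))"
      using assms
      by (auto intro!: derivative_eq_intros simp: field_simps power2_eq_square power3_eq_cube)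
    from has_vector_derivative_real_field[OF this]
    show "(?F has_vector_derivative of_real (t ^ 2) * exp (- z * of_real t)) (at t within {0..T})"
      by simp
  qed (use assms in auto)
  then show ?thesis unfolding laplace_moment_def by (simp add: integral_unique)
qed

text \<open>The contribution of the far end is estimated with \<open>\<bar>1 / z\<bar> \<le> y\<close> only; it carries
  \<open>exp (- T / y)\<close>, which the cutoff condition makes small enough to absorb these powers of
  \<open>y\<close>.\<close>

lemma laplace_moment_1_approx:
  assumes "cutoff y T" "1 / y \<le> Re z"
  shows "cmod (laplace_moment 1 T z - 1 / z\<^sup>2) \<le> y"
proof -
  have y: "1 \<le> y" "0 \<le> T" "exp (- T / y) * (2 + 2 * (T / y) + (T / y)\<^sup>2) \<le> 1 / y"
    using assms by (auto simp: cutoff_def)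
  have z: "1 / y \<le> cmod z" using assms(2) complex_Re_le_cmod[of z] by linarith
  then have z0: "cmod z > 0" using y by (smt (verit) divide_pos_pos)
  have iz: "1 / cmod z \<le> y" using z z0 y by (simp add: field_simps)
  have ex: "cmod (exp (- z * of_real T)) \<le> exp (- T / y)"
    using mult_right_mono[OF assms(2) y(2)] by (simp add: norm_exp_eq_Re)
  have "cmod (laplace_moment 1 T z - 1 / z\<^sup>2) =
      cmod (exp (- z * of_real T)) * cmod ((1 / z)\<^sup>2 + of_real T * (1 / z))"
  proof -
    have "laplace_moment 1 T z - 1 / z\<^sup>2 = - (exp (- z * of_real T) * ((1 / z)\<^sup>2 + of_real T * (1 / z)))"
      using z0 y by (subst laplace_moment_1_eq) (auto simp: field_simps power2_eq_square)
    then show ?thesis by (simp add: norm_mult)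
  qed
  also have "\<dots> \<le> exp (- T / y) * ((1 / cmod z)\<^sup>2 + T * (1 / cmod z))"
    using y by (intro mult_mono ex order.trans[OF norm_triangle_ineq])
      (auto simp: norm_divide norm_mult norm_power power_divide)
  also have "\<dots> \<le> exp (- T / y) * (y\<^sup>2 + T * y)"
    using y iz z0 by (intro mult_left_mono add_mono power_mono) auto
  also have "\<dots> = y\<^sup>2 * (exp (- T / y) * (1 + T / y))"
    using y by (simp add: field_simps power2_eq_square)
  also have "\<dots> \<le> y\<^sup>2 * (1 / y)"
    using y by (intro mult_left_mono order.trans[OF mult_left_mono y(3)]) (auto simp: field_simps)
  finally show ?thesis using y by (simp add: power2_eq_square)
qed

lemma laplace_moment_2_approx:
  assumes "cutoff y T" "1 / y \<le> Re z"
  shows "cmod (laplace_moment 2 T z - 2 / z^3) \<le> y\<^sup>2"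
proof -
  have y: "1 \<le> y" "0 \<le> T" "exp (- T / y) * (2 + 2 * (T / y) + (T / y)\<^sup>2) \<le> 1 / y"
    using assms by (auto simp: cutoff_def)
  have z: "1 / y \<le> cmod z" using assms(2) complex_Re_le_cmod[of z] by linarith
  then have z0: "cmod z > 0" using y by (smt (verit) divide_pos_pos)
  have iz: "1 / cmod z \<le> y" using z z0 y by (simp add: field_simps)
  have ex: "cmod (exp (- z * of_real T)) \<le> exp (- T / y)"
    using mult_right_mono[OF assms(2) y(2)] by (simp add: norm_exp_eq_Re)
  have "cmod (laplace_moment 2 T z - 2 / z^3) =
      cmod (exp (- z * of_real T)) * cmod (2 * (1 / z)^3 + 2 * of_real T * (1 / z)\<^sup>2 + (of_real T)\<^sup>2 * (1 / z))"
  proof -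
    have "laplace_moment 2 T z - 2 / z^3 = - (exp (- z * of_real T) *
        (2 * (1 / z)^3 + 2 * of_real T * (1 / z)\<^sup>2 + (of_real T)\<^sup>2 * (1 / z)))"
      using z0 y by (subst laplace_moment_2_eq) (auto simp: field_simps power2_eq_square power3_eq_cube)
    then show ?thesis by (simp add: norm_mult)
  qed
  also have "\<dots> \<le> exp (- T / y) * (2 * (1 / cmod z)^3 + 2 * T * (1 / cmod z)\<^sup>2 + T\<^sup>2 * (1 / cmod z))"
    using y by (intro mult_mono ex order.trans[OF norm_triangle_ineq] add_mono)
      (auto simp: norm_divide norm_mult norm_power power_divide)
  also have "\<dots> \<le> exp (- T / y) * (2 * y^3 + 2 * T * y\<^sup>2 + T\<^sup>2 * y)"
    using y iz z0 by (intro mult_left_mono add_mono power_mono) auto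
  also have "\<dots> = y^3 * (exp (- T / y) * (2 + 2 * (T / y) + (T / y)\<^sup>2))"
    using y by (simp add: field_simps power2_eq_square power3_eq_cube)
  also have "\<dots> \<le> y^3 * (1 / y)"
    using y by (intro mult_left_mono y(3)) auto
  finally show ?thesis using y by (simp add: power2_eq_square power3_eq_cube)
qed

text \<open>Interpolation between \<open>1 / r \<le> y\<close>, effective near the diagonal, and
  \<open>1 / r \<le> 1 / l\<close>, effective away from it.  Exactly the power \<open>3/2\<close> of \<open>l\<close> is
  spent, so that the result can be summed over the distance to the diagonal.\<close>

lemma inverse_power_le:
  assumes "1 \<le> y" "1 / y \<le> r" "0 < l" "l \<le> r" and k: "2 \<le> k"
  shows "1 / r ^ k \<le> y powr (real k - 3/2) * l powr (- (3/2))"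
proof -
  have r: "0 < r" using assms by linarith
  have "1 / r ^ k = r powr (- (real k - 3/2)) * r powr (- (3/2))"
    using r by (simp add: powr_add[symmetric] powr_minus powr_realpow field_simps)
  also have "\<dots> \<le> (1 / y) powr (- (real k - 3/2)) * l powr (- (3/2))"
    using assms r by (intro mult_mono powr_mono2') auto
  also have "(1 / y) powr (- (real k - 3/2)) = y powr (real k - 3/2)"
    using assms by (simp add: powr_minus powr_divide del: minus_diff_eq)
  finally show ?thesis .
qed

text \<open>Frequencies are logarithms of the summation variables, and \<open>ln b - ln a \<ge> (b - a) / b\<close>.\<close>

lemma log_ratio_powr_le:
  fixes a b :: real assumes "0 < a" "a < b"
  shows "(ln b - ln a) powr (- (3/2)) \<le> b powr (3/2) * (b - a) powr (- (3/2))"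
proof -
  have "(b - a) / b \<le> ln b - ln a"
    using ln_le_minus_one[of "a / b"] assms by (simp add: ln_div field_simps)
  then have "(ln b - ln a) powr (- (3/2)) \<le> ((b - a) / b) powr (- (3/2))"
    using assms by (intro powr_mono2') auto
  also have "\<dots> = b powr (3/2) * (b - a) powr (- (3/2))"
    using assms by (simp add: powr_divide powr_minus field_simps)
  finally show ?thesis .
qed

lemma laplace_moment_le:
  assumes c: "cutoff y T" "1 / y \<le> c" and ab: "0 < a" "a < b" and l: "\<bar>l\<bar> = ln b - ln a"
  shows "cmod (laplace_moment 1 T (Complex c l)) \<le> y powr (1/2) * (b powr (3/2) * (b - a) powr (- (3/2))) + y"
    and "cmod (laplace_moment 2 T (Complex c l)) \<le> 2 * y powr (3/2) * (b powr (3/2) * (b - a) powr (- (3/2))) + y\<^sup>2"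
proof -
  let ?z = "Complex c l"
  have y: "1 \<le> y" using c by (simp add: cutoff_def)
  have "0 < ln b - ln a" using ab by simp
  have rz: "1 / y \<le> cmod ?z" "ln b - ln a \<le> cmod ?z"
    using c(2) l abs_Re_le_cmod[of ?z] abs_Im_le_cmod[of ?z] by auto
  have 1: "1 / cmod ?z ^ k \<le> y powr (real k - 3/2) * (b powr (3/2) * (b - a) powr (- (3/2)))"
    if "2 \<le> k" for k
    using inverse_power_le[OF y rz(1) _ rz(2) that] \<open>0 < ln b - ln a\<close>
      mult_left_mono[OF log_ratio_powr_le[OF ab], of "y powr (real k - 3/2)"] by simp
  have "cmod (laplace_moment 1 T ?z) \<le> cmod (1 / ?z\<^sup>2) + y"
    using laplace_moment_1_approx[OF c(1), of ?z] c(2) norm_triangle_ineq2[of "laplace_moment 1 T ?z" "1 / ?z\<^sup>2"] by simp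
  also have "cmod (1 / ?z\<^sup>2) \<le> y powr (1/2) * (b powr (3/2) * (b - a) powr (- (3/2)))"
    using 1[of 2] by (simp add: norm_divide norm_power)
  finally show "cmod (laplace_moment 1 T ?z) \<le> y powr (1/2) * (b powr (3/2) * (b - a) powr (- (3/2))) + y" by simp
  have "cmod (laplace_moment 2 T ?z) \<le> cmod (2 / ?z^3) + y\<^sup>2"
    using laplace_moment_2_approx[OF c(1), of ?z] c(2) norm_triangle_ineq2[of "laplace_moment 2 T ?z" "2 / ?z^3"] by simp
  also have "cmod (2 / ?z^3) \<le> 2 * y powr (3/2) * (b powr (3/2) * (b - a) powr (- (3/2)))"
    using 1[of 3] by (simp add: norm_divide norm_power)
  finally show "cmod (laplace_moment 2 T ?z) \<le> 2 * y powr (3/2) * (b powr (3/2) * (b - a) powr (- (3/2))) + y\<^sup>2" by simp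
qed

lemma exp_Complex_mult: "exp (- Complex c l * of_real t) = of_real (exp (- c * t)) * cis (- l * t)"
  by (auto simp: complex_eq_iff Re_exp Im_exp)

lemma laplace_moment_cnj: "laplace_moment k T (cnj z) = cnj (laplace_moment k T z)"
  by (simp add: laplace_moment_def integral_cnj exp_cnj)

lemma laplace_moment_integrable: "(\<lambda>t. of_real (t ^ k) * exp (- z * of_real t) :: complex) integrable_on {0..T}"
  by (intro integrable_continuous_interval continuous_intros)

section \<open>Weighted mean values of Dirichlet polynomials\<close>

text \<open>Generalised Dirichlet polynomials on the shifted points \<open>n + u\<close>.  The shift allows for the
  Dirichlet polynomials that occur under the integral over the fractional part \<open>u\<close> in
  Euler-Maclaurin summation.\<close>

definition dpoly :: "nat set \<Rightarrow> (nat \<Rightarrow> real) \<Rightarrow> real \<Rightarrow> real \<Rightarrow> complex" where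
  "dpoly A a u t = (\<Sum>n\<in>A. of_real (a n) * cis (- ln (real n + u) * t))"

lemma dpoly_weighted_product:
  "of_real (exp (- c * t)) * (dpoly A a u t * cnj (dpoly B b v t)) =
   (\<Sum>m\<in>A. \<Sum>n\<in>B. of_real (a m * b n) *
      exp (- Complex c (ln (real m + u) - ln (real n + v)) * of_real t))"
proof -
  have "cis (- ln (real m + u) * t) * cnj (cis (- ln (real n + v) * t)) =
      cis (- (ln (real m + u) - ln (real n + v)) * t)" for m n
    by (simp add: cis_cnj cis_mult algebra_simps)
  then have "of_real (exp (- c * t)) * ((of_real (a m) * cis (- ln (real m + u) * t)) *
        cnj (of_real (b n) * cis (- ln (real n + v) * t))) =
      of_real (a m * b n) * exp (- Complex c (ln (real m + u) - ln (real n + v)) * of_real t)" for m n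
    unfolding exp_Complex_mult by (simp add: mult_ac)
  then show ?thesis
    unfolding dpoly_def cnj_sum sum_product by (simp only: sum_distrib_left)
qed

lemma integral_weighted_product:
  assumes "finite A" "finite B"
  shows "integral {0..T} (\<lambda>t. of_real (t ^ k * exp (- c * t)) * (dpoly A a u t * cnj (dpoly B b v t))) =
    (\<Sum>m\<in>A. \<Sum>n\<in>B. of_real (a m * b n) * laplace_moment k T (Complex c (ln (real m + u) - ln (real n + v))))"
proof (rule integral_unique)
  have *: "of_real (t ^ k * exp (- c * t)) * (dpoly A a u t * cnj (dpoly B b v t)) =
    (\<Sum>m\<in>A. \<Sum>n\<in>B. of_real (a m * b n) *
      (of_real (t ^ k) * exp (- Complex c (ln (real m + u) - ln (real n + v)) * of_real t)))" for t
    using arg_cong[OF dpoly_weighted_product[of c t A a u B b v], of "\<lambda>w. of_real (t ^ k) * w"]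
    by (simp only: sum_distrib_left of_real_mult mult_ac)
  show "((\<lambda>t. of_real (t ^ k * exp (- c * t)) * (dpoly A a u t * cnj (dpoly B b v t))) has_integral
    (\<Sum>m\<in>A. \<Sum>n\<in>B. of_real (a m * b n) * laplace_moment k T (Complex c (ln (real m + u) - ln (real n + v))))) {0..T}"
    unfolding * laplace_moment_def using assms
    by (intro has_integral_sum has_integral_mult_right integrable_integral laplace_moment_integrable)
qed

text \<open>The diagonal gives the first moment of the weight.  The weight \<open>t * exp (- c * t)\<close> vanishes at
  the origin, so its Laplace transform decays like the inverse square of the frequency difference;
  the off-diagonal terms can therefore be summed in absolute value without losing a logarithm.  The
  bound \<open>C\<close> for the coefficients absorbs the factor that relates logarithmic to ordinary
  differences.\<close>

lemma dpoly_mean_square: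
  assumes c: "cutoff y T" "1 / y \<le> c" and A: "finite A" "\<And>n. n \<in> A \<Longrightarrow> 1 \<le> n" and u: "0 \<le> u"
    and a: "\<And>n. n \<in> A \<Longrightarrow> 0 \<le> a n" and C: "\<And>n. n \<in> A \<Longrightarrow> 0 \<le> C n"
    and off: "\<And>m n. m \<in> A \<Longrightarrow> n \<in> A \<Longrightarrow> m < n \<Longrightarrow> a m * a n * (real n + u) powr (3/2) \<le> C m"
  shows "cmod (integral {0..T} (\<lambda>t. of_real (t ^ 1 * exp (- c * t)) * (dpoly A a u t * cnj (dpoly A a u t)))
     - of_real (\<Sum>n\<in>A. (a n)\<^sup>2) * laplace_moment 1 T (of_real c))
    \<le> 8 * y powr (1/2) * (\<Sum>n\<in>A. C n) + y * (\<Sum>n\<in>A. a n)\<^sup>2"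
proof -
  have y: "1 \<le> y" using c by (simp add: cutoff_def)
  define K where "K = (\<lambda>m n. laplace_moment 1 T (Complex c (ln (real m + u) - ln (real n + u))))"
  \<comment> \<open>Half of the off-diagonal bound; the other half is its transpose.\<close>
  define h where "h = (\<lambda>m n. if m < n then C m * (real n - real m) powr (- (3/2)) else 0)"
  have Kle: "a m * a n * cmod (K m n) \<le> y powr (1/2) * h m n + y * (a m * a n)"
    if mn: "m \<in> A" "n \<in> A" "m < n" for m n
  proof -
    have "cmod (K m n) \<le> y powr (1/2) * ((real n + u) powr (3/2) * (real n - real m) powr (- (3/2))) + y"
      using laplace_moment_le(1)[OF c, of "real m + u" "real n + u" "ln (real m + u) - ln (real n + u)"] A(2)[OF mn(1)] u mn
      by (simp add: K_def)
    then have "a m * a n * cmod (K m n) \<le> a m * a n *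
        (y powr (1/2) * ((real n + u) powr (3/2) * (real n - real m) powr (- (3/2))) + y)"
      using a mn by (intro mult_left_mono) auto
    also have "\<dots> = y powr (1/2) * ((a m * a n * (real n + u) powr (3/2)) * (real n - real m) powr (- (3/2))) + y * (a m * a n)"
      by (simp add: algebra_simps)
    also have "\<dots> \<le> y powr (1/2) * (C m * (real n - real m) powr (- (3/2))) + y * (a m * a n)"
      using off[OF mn] by (intro add_right_mono mult_left_mono mult_right_mono) auto
    finally show ?thesis using that by (simp add: h_def)
  qed
  have Ksym: "cmod (K m n) = cmod (K n m)" for m n
  proof -
    have "K n m = cnj (K m n)"
    proof -
      have "Complex c (ln (real n + u) - ln (real m + u)) = cnj (Complex c (ln (real m + u) - ln (real n + u)))"
        by (simp add: complex_eq_iff)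
      then show ?thesis unfolding K_def by (simp only: laplace_moment_cnj)
    qed
    then show ?thesis by simp
  qed
  have hsum: "(\<Sum>n\<in>A. h m n) \<le> 4 * C m" if m: "m \<in> A" for m
  proof -
    obtain L where L: "A \<subseteq> {..<L}" using A(1) finite_nat_iff_bounded by blast
    have "(\<Sum>n\<in>A. h m n) = (\<Sum>n\<in>A \<inter> {m<..}. h m n)"
      using A(1) by (intro sum.mono_neutral_right) (auto simp: h_def)
    also have "\<dots> = C m * (\<Sum>n\<in>A \<inter> {m<..}. (- real m + real n) powr (- (3/2)))"
      unfolding sum_distrib_left by (intro sum.cong) (auto simp: h_def)
    also have "\<dots> \<le> C m * (\<Sum>n = Suc m..<L. (- real m + real n) powr (- (3/2)))"
      using L C[OF m] by (intro mult_left_mono sum_mono2) auto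
    also have "\<dots> \<le> C m * (4 * (- real m + real (Suc m)) powr (- (1/2)))"
      using C[OF m] by (intro mult_left_mono sum_powr_three_halves_le) auto
    finally show ?thesis by simp
  qed
  have "integral {0..T} (\<lambda>t. of_real (t ^ 1 * exp (- c * t)) * (dpoly A a u t * cnj (dpoly A a u t)))
     = (\<Sum>m\<in>A. \<Sum>n\<in>A. of_real (a m * a n) * K m n)"
    unfolding K_def by (rule integral_weighted_product[OF A(1) A(1)])
  also have "\<dots> = (\<Sum>m\<in>A. of_real (a m * a m) * laplace_moment 1 T (of_real c) + (\<Sum>n\<in>A - {m}. of_real (a m * a n) * K m n))"
    using A(1) by (intro sum.cong refl, subst sum.remove) (auto simp: K_def complex_of_real_def)
  also have "\<dots> = of_real (\<Sum>n\<in>A. (a n)\<^sup>2) * laplace_moment 1 T (of_real c) + (\<Sum>m\<in>A. \<Sum>n\<in>A - {m}. of_real (a m * a n) * K m n)"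
    by (simp add: sum.distrib sum_distrib_right power2_eq_square)
  finally have "cmod (integral {0..T} (\<lambda>t. of_real (t ^ 1 * exp (- c * t)) * (dpoly A a u t * cnj (dpoly A a u t)))
     - of_real (\<Sum>n\<in>A. (a n)\<^sup>2) * laplace_moment 1 T (of_real c)) = cmod (\<Sum>m\<in>A. \<Sum>n\<in>A - {m}. of_real (a m * a n) * K m n)"
    by simp
  also have "\<dots> \<le> (\<Sum>m\<in>A. \<Sum>n\<in>A - {m}. a m * a n * cmod (K m n))"
    using a by (intro order.trans[OF norm_sum] sum_mono) (auto simp: norm_mult abs_mult intro!: mult_nonneg_nonneg)
  also have "\<dots> \<le> (\<Sum>m\<in>A. \<Sum>n\<in>A - {m}. y powr (1/2) * (h m n + h n m) + y * (a m * a n))"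
  proof (intro sum_mono)
    fix m n assume mn: "m \<in> A" "n \<in> A - {m}"
    show "a m * a n * cmod (K m n) \<le> y powr (1/2) * (h m n + h n m) + y * (a m * a n)"
    proof (cases "m < n")
      case True
      then show ?thesis using Kle[of m n] mn by (simp add: h_def)
    next
      case False
      then have "n < m" using mn by auto
      then show ?thesis using Kle[of n m] mn Ksym[of m n] by (simp add: h_def mult_ac)
    qed
  qed
  also have "\<dots> \<le> (\<Sum>m\<in>A. \<Sum>n\<in>A. y powr (1/2) * (h m n + h n m) + y * (a m * a n))"
  proof (intro sum_mono sum_mono2 A)
    fix m n assume "m \<in> A" "n \<in> A - (A - {m})"
    then show "0 \<le> y powr (1/2) * (h m n + h n m) + y * (a m * a n)"
      using a[of m] y by (simp add: h_def)
  qed auto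
  also have "\<dots> = y powr (1/2) * (2 * (\<Sum>m\<in>A. \<Sum>n\<in>A. h m n)) + y * (\<Sum>n\<in>A. a n)\<^sup>2"
  proof -
    have "(\<Sum>m\<in>A. \<Sum>n\<in>A. h n m) = (\<Sum>m\<in>A. \<Sum>n\<in>A. h m n)" by (rule sum.swap)
    then show ?thesis
      by (simp add: sum.distrib distrib_left power2_eq_square sum_product flip: sum_distrib_left)
  qed
  also have "\<dots> \<le> y powr (1/2) * (2 * (\<Sum>m\<in>A. 4 * C m)) + y * (\<Sum>n\<in>A. a n)\<^sup>2"
    using hsum by (intro add_right_mono mult_left_mono sum_mono) auto
  also have "\<dots> = 8 * y powr (1/2) * (\<Sum>n\<in>A. C n) + y * (\<Sum>n\<in>A. a n)\<^sup>2"
    by (simp add: sum_distrib_left[symmetric])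
  finally show ?thesis .
qed

text \<open>The two polynomials have disjoint ranges of frequencies that only touch at \<open>N\<close>, so there is no
  diagonal and the inner product is small.  The terms with \<open>n\<close> close to \<open>m\<close> are controlled by
  \<open>(n + u - m) powr (- (3/2))\<close>, where \<open>n + u - m \<ge> 1\<close>.\<close>

lemma dpoly_cross:
  assumes u: "0 \<le> u" and N: "1 \<le> N" and pq: "0 \<le> p" "0 \<le> q"
    and ker: "\<And>a b l. 0 < a \<Longrightarrow> a < b \<Longrightarrow> l = ln b - ln a \<Longrightarrow>
      cmod (laplace_moment k T (Complex c l)) \<le> p * (b powr (3/2) * (b - a) powr (- (3/2))) + q"
  shows "cmod (integral {0..T} (\<lambda>t. of_real (t ^ k * exp (- c * t)) *
     (dpoly {N..<K} (\<lambda>n. (real n + u) powr (- (3/2))) u t *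
      cnj (dpoly {1..<N} (\<lambda>n. real n powr (- (1/2))) 0 t)))) \<le> 8 * p * sqrt (real N) + 8 * q"
proof -
  let ?b = "\<lambda>n. (real n + u) powr (- (3/2))" and ?a = "\<lambda>m. real m powr (- (1/2))"
  let ?K = "\<lambda>n m. laplace_moment k T (Complex c (ln (real n + u) - ln (real m + 0)))"
  have "cmod (\<Sum>n = N..<K. \<Sum>m = 1..<N. of_real (?b n * ?a m) * ?K n m)
    \<le> (\<Sum>n = N..<K. \<Sum>m = 1..<N. ?b n * ?a m * cmod (?K n m))"
    by (intro order.trans[OF norm_sum] sum_mono) (auto simp: norm_mult abs_mult)
  also have "\<dots> \<le> (\<Sum>n = N..<K. \<Sum>m = 1..<N. p * (?a m * (real n + u - real m) powr (- (3/2))) + q * (?a m * ?b n))"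
  proof (intro sum_mono)
    fix n m assume nm: "n \<in> {N..<K}" "m \<in> {1..<N}"
    have "?b n * ?a m * cmod (?K n m) \<le> ?b n * ?a m *
      (p * ((real n + u) powr (3/2) * (real n + u - real m) powr (- (3/2))) + q)"
      using nm u ker[of "real m" "real n + u"] by (intro mult_left_mono) auto
    also have "\<dots> = p * ((?b n * (real n + u) powr (3/2)) * (?a m * (real n + u - real m) powr (- (3/2)))) + q * (?a m * ?b n)"
      by (simp add: algebra_simps)
    also have "?b n * (real n + u) powr (3/2) = 1"
      using nm u by (simp add: powr_add[symmetric])
    finally show "?b n * ?a m * cmod (?K n m) \<le> p * (?a m * (real n + u - real m) powr (- (3/2))) + q * (?a m * ?b n)"
      by simp
  qed
  also have "\<dots> = p * (\<Sum>m = 1..<N. ?a m * (\<Sum>n = N..<K. (u - real m + real n) powr (- (3/2)))) +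
      q * ((\<Sum>m = 1..<N. ?a m) * (\<Sum>n = N..<K. (u + real n) powr (- (3/2))))"
  proof -
    have f: "real n + u - real m = u - real m + real n" "u + real n - real m = u - real m + real n"
      "real n + u = u + real n" for m n by auto
    have "(\<Sum>n = N..<K. p * (?a m * (real n + u - real m) powr (- (3/2))) + q * (?a m * ?b n)) =
       p * (?a m * (\<Sum>n = N..<K. (u - real m + real n) powr (- (3/2)))) +
       q * (?a m * (\<Sum>n = N..<K. (u + real n) powr (- (3/2))))" for m
      unfolding f by (simp only: sum.distrib sum_distrib_left)
    then show ?thesis
      by (subst sum.swap) (simp only: sum.distrib sum_distrib_left[symmetric] sum_distrib_right)
  qed
  also have "\<dots> \<le> p * (\<Sum>m = 1..<N. ?a m * 4) + q * ((2 * sqrt (real N)) * (4 * real N powr (- (1/2))))"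
  proof (intro add_mono mult_left_mono sum_mono mult_mono pq sum_powr_half_le sum_nonneg)
    fix m assume m: "m \<in> {1..<N}"
    have "(\<Sum>n = N..<K. (u - real m + real n) powr (- (3/2))) \<le> 4 * (u - real m + real N) powr (- (1/2))"
      using m u by (intro sum_powr_three_halves_le) auto
    also have "(u - real m + real N) powr (- (1/2)) \<le> 1 powr (- (1/2))"
      using m u by (intro powr_mono2') auto
    finally show "(\<Sum>n = N..<K. (u - real m + real n) powr (- (3/2))) \<le> 4" by simp
  next
    have "(\<Sum>n = N..<K. (u + real n) powr (- (3/2))) \<le> 4 * (u + real N) powr (- (1/2))"
      using u N by (intro sum_powr_three_halves_le) auto
    also have "(u + real N) powr (- (1/2)) \<le> real N powr (- (1/2))"
      using u N by (intro powr_mono2') auto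
    finally show "(\<Sum>n = N..<K. (u + real n) powr (- (3/2))) \<le> 4 * real N powr (- (1/2))" by simp
  qed auto
  also have "\<dots> \<le> p * (4 * (2 * sqrt (real N))) + q * 8"
  proof -
    have "(\<Sum>m = 1..<N. ?a m * 4) \<le> 4 * (2 * sqrt (real N))"
      using sum_powr_half_le[of N] by (simp flip: sum_distrib_right)
    moreover have "sqrt (real N) * real N powr (- (1/2)) = 1"
      using N by (simp add: powr_minus powr_half_sqrt)
    then have "(2 * sqrt (real N)) * (4 * real N powr (- (1/2))) = 8" by simp
    ultimately show ?thesis using pq by (metis add_mono mult_left_mono order_refl)
  qed
  finally show ?thesis
    by (subst integral_weighted_product) (auto simp: mult_ac)
qed

section \<open>Zeta on the critical line\<close>

lemma of_real_powr_Complex: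
  "0 < x \<Longrightarrow> of_real x powr Complex a b = of_real (x powr a) * cis (b * ln x)"
  by (auto simp: powr_def Ln_of_real exp_eq_polar complex_eq_iff Re_exp Im_exp)

lemma cmod_dpoly_le: "cmod (dpoly A a u t) \<le> (\<Sum>n\<in>A. \<bar>a n\<bar>)"
  unfolding dpoly_def by (rule order.trans[OF norm_sum]) (simp add: norm_mult)

lemma continuous_on_dpoly [continuous_intros]: "continuous_on X (dpoly A a u)"
  unfolding dpoly_def cis_conv_exp by (intro continuous_intros)

abbreviation zsum :: "nat \<Rightarrow> real \<Rightarrow> complex" where
  "zsum N \<equiv> dpoly {1..<N} (\<lambda>n. real n powr (- (1/2))) 0"

lemma zsum_eq: "zsum N t = (\<Sum>n = 1..<N. of_nat n powr (- Complex (1/2) t))"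
proof -
  have "of_nat n powr (- Complex (1/2) t) = of_real (real n powr (- (1/2))) * cis (- ln (real n + 0) * t)"
    if "n \<in> {1..<N}" for n
  proof -
    have "- Complex (1/2) t = Complex (- (1/2)) (- t)" by (simp add: complex_eq_iff)
    then show ?thesis
      using of_real_powr_Complex[of "real n" "- (1/2)" "- t"] that by (simp add: mult.commute)
  qed
  then show ?thesis unfolding dpoly_def by simp
qed

text \<open>The term of the Euler-Maclaurin formula that carries the pole of zeta: the analytic continuation of
  the integral of \<open>x powr (- s)\<close> over \<open>[N, \<infinity>)\<close>.\<close>

definition pole_term :: "nat \<Rightarrow> real \<Rightarrow> complex" where
  "pole_term N t = of_nat N powr (1 - Complex (1/2) t) / (Complex (1/2) t - 1)"

lemma cmod_critical_line_minus_1: "cmod (Complex (1/2) t - 1) = sqrt (1/4 + t\<^sup>2)"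
  by (simp add: cmod_def power2_eq_square)

lemma cmod_pole_term: "1 \<le> N \<Longrightarrow> cmod (pole_term N t) = sqrt (real N) / sqrt (1/4 + t\<^sup>2)"
  using norm_powr_real_powr[of "of_real (real N)" "1 - Complex (1/2) t"]
  by (simp add: pole_term_def norm_divide cmod_critical_line_minus_1 powr_half_sqrt)

lemma continuous_on_pole_term [continuous_intros]: "1 \<le> N \<Longrightarrow> continuous_on X (pole_term N)"
  unfolding pole_term_def Complex_eq
  by (intro continuous_intros) (auto simp: complex_eq_iff)

lemma continuous_on_zeta [continuous_intros]: "continuous_on X (\<lambda>t. zeta (Complex (1/2) t))"
proof -
  have "continuous_on X (zeta \<circ> (\<lambda>t. Complex (1/2) t))"
    unfolding Complex_eq
    by (intro continuous_on_compose continuous_intros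
      continuous_on_subset[OF holomorphic_on_imp_continuous_on[OF zeta_holomorphic]])
      (auto simp: complex_eq_iff)
  then show ?thesis by (simp add: o_def)
qed

text \<open>A crude approximation, good only when \<open>N\<close> is much larger than \<open>t\<^sup>2\<close>.  It serves to replace
  zeta by a finite expression with a cut at an extremely large \<open>K\<close>, and for \<open>N = 1\<close> gives the
  trivial growth bound on the critical line.\<close>

lemma zeta_truncation:
  assumes N: "1 \<le> N"
  shows "cmod (zeta (Complex (1/2) t) - zsum N t - pole_term N t) \<le>
    4 * cmod (Complex (1/2) t) / sqrt (real N)"
proof -
  define s where "s = Complex (1/2) t"
  have s: "s \<noteq> 1" "Re s = 1/2" by (auto simp: s_def complex_eq_iff)
  have rem: "power_rem 1 n s = of_nat (Suc (Suc n)) powr (1 - s) - of_nat (Suc n) powr (1 - s)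
      + (s - 1) * of_nat (Suc n) powr (- s)" for n
    by (simp add: power_rem_def algebra_simps)
  have part: "(\<Sum>n<M. power_rem 1 n s) =
      of_nat (Suc M) powr (1 - s) - 1 + (s - 1) * (\<Sum>n = 1..<Suc M. of_nat n powr (- s))" for M
  proof (induction M)
    case (Suc M)
    then show ?case unfolding sum.lessThan_Suc rem by (simp add: algebra_simps)
  qed auto
  have sums: "(\<lambda>n. power_rem 1 n s) sums (\<Sum>n. power_rem 1 n s)"
    using s by (intro power_rem_series(2)) auto
  obtain M where M: "N = Suc M" using N by (cases N) auto
  define X where "X = (s - 1) * (zeta s - zsum N t - pole_term N t)"
  have "(s - 1) * zeta s = 1 + (\<Sum>n. power_rem 1 n s)"
    using s by (intro zeta_eq_power_rem) auto
  moreover have "(s - 1) * pole_term N t = of_nat N powr (1 - s)" using s by (simp add: pole_term_def s_def)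
  ultimately have X: "X = (\<Sum>n. power_rem 1 n s) - (\<Sum>n<M. power_rem 1 n s)"
    unfolding X_def part zsum_eq s_def[symmetric] M right_diff_distrib by simp
  have lim: "(\<lambda>n. \<Sum>i<n. power_rem 1 (i + M) s) \<longlonglongrightarrow> X"
    using sums_split_initial_segment[OF sums, of M] unfolding X sums_def .
  have "cmod X \<le> cmod (s - 1) * cmod s * (4 * real N powr (- (1/2)))"
  proof (rule LIMSEQ_le_const2[OF tendsto_norm[OF lim]], intro exI allI impI)
    fix n :: nat
    have "cmod (\<Sum>i<n. power_rem 1 (i + M) s) \<le> (\<Sum>i<n. cmod (falling (1 - s) 2) * (real N + real i) powr (- (3/2)))"
    proof (rule order.trans[OF norm_sum], rule sum_mono)
      fix i
      have *: "real (Suc (i + M)) = real N + real i" "- (Re s + real 1) = - (3/2)" "Suc 1 = 2"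
        using M s by auto
      show "cmod (power_rem 1 (i + M) s) \<le> cmod (falling (1 - s) 2) * (real N + real i) powr (- (3/2))"
        using norm_power_rem_le[of s 1 "i + M"] s unfolding * by simp
    qed
    also have "\<dots> = cmod (falling (1 - s) 2) * (\<Sum>i = 0..<n. (real N + real i) powr (- (3/2)))"
      by (simp add: sum_distrib_left atLeast0LessThan)
    also have "\<dots> \<le> cmod (falling (1 - s) 2) * (4 * (real N + real 0) powr (- (1/2)))"
      using N by (intro mult_left_mono sum_powr_three_halves_le) auto
    also have "falling (1 - s) 2 = (s - 1) * s" by (simp add: numeral_2_eq_2 algebra_simps)
    finally show "cmod (\<Sum>i<n. power_rem 1 (i + M) s) \<le> cmod (s - 1) * cmod s * (4 * real N powr (- (1/2)))"
      by (simp add: norm_mult)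
  qed
  then have "cmod (zeta s - zsum N t - pole_term N t) \<le> cmod s * (4 * real N powr (- (1/2)))"
    using s by (simp add: X_def norm_mult mult.assoc)
  then show ?thesis using N by (simp add: s_def powr_minus powr_half_sqrt field_simps)
qed

abbreviation tail_poly :: "nat \<Rightarrow> nat \<Rightarrow> real \<Rightarrow> real \<Rightarrow> complex" where
  "tail_poly N K u \<equiv> dpoly {N..<K} (\<lambda>n. (real n + u) powr (- (3/2))) u"

lemma tail_poly_jointly_continuous:
  assumes "1 \<le> N"
  shows "continuous_on (X \<times> {0..1}) (\<lambda>(t, u). tail_poly N K u t)"
  unfolding dpoly_def case_prod_beta cis_conv_exp
  using assms by (intro continuous_intros) (auto simp: add_nonneg_eq_0_iff)

text \<open>Integration by parts on each unit interval turns the difference of the expressions cut at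
  \<open>K\<close> and at \<open>N\<close> into an average of Dirichlet polynomials with coefficients of size
  \<open>n powr (- (3/2))\<close>.  The price is the factor \<open>s\<close>.\<close>

lemma zeta_block:
  assumes "1 \<le> N" "N \<le> K"
  shows "((\<lambda>u. of_real (1 - u) * tail_poly N K u t) has_integral
    (zsum K t + pole_term K t - zsum N t - pole_term N t) / Complex (1/2) t) {0..1}"
proof -
  define s where "s = Complex (1/2) t"
  have s: "s \<noteq> 1" "s \<noteq> 0" by (auto simp: s_def complex_eq_iff)
  have one: "((\<lambda>u. of_real (1 - u) * of_real (real n + u) powr (- s - 1)) has_integral
      (of_nat n powr (- s) + (of_nat (Suc n) powr (1 - s) - of_nat n powr (1 - s)) / (s - 1)) / s) {0..1}"
    if n: "1 \<le> n" for n
  proof -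
    let ?F = "\<lambda>w. (- (1 - w) * (of_nat n + w) powr (- s) + (of_nat n + w) powr (1 - s) / (s - 1)) / s"
    have "((\<lambda>u. of_real (1 - u) * of_real (real n + u) powr (- s - 1)) has_integral
       ((\<lambda>x. ?F (of_real x)) 1 - (\<lambda>x. ?F (of_real x)) 0)) {0..1}"
    proof (rule fundamental_theorem_of_calculus)
      fix u :: real assume u: "u \<in> {0..1}"
      have nu: "of_nat n + of_real u = complex_of_real (real n + u)" by simp
      have ni: "of_nat n + complex_of_real u \<notin> \<real>\<^sub>\<le>\<^sub>0"
        using u n unfolding nu nonpos_Reals_of_real_iff by auto
      \<comment> \<open>In the derivative of \<open>?F\<close> the two terms without the factor \<open>1 - u\<close> cancel.\<close>
      have d0: "((\<lambda>w. - (1 - w)) has_field_derivative 1) (at (complex_of_real u))"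
        by (auto intro!: derivative_eq_intros)
      have d1: "((\<lambda>w. (of_nat n + w) powr z) has_field_derivative
          z * (of_nat n + of_real u) powr (z - 1)) (at (complex_of_real u))" for z
        using ni by (auto intro!: derivative_eq_intros)
      have "((1 - s) * (of_nat n + of_real u) powr (1 - s - 1)) / (s - 1) = - ((of_nat n + of_real u) powr (- s))"
        using s by (simp add: field_simps)
      then have "(?F has_field_derivative (of_real (1 - u) * of_real (real n + u) powr (- s - 1))) (at (of_real u))"
        using s by (intro DERIV_cong[OF DERIV_cdivide[OF DERIV_add[OF DERIV_mult[OF d0 d1]
          DERIV_cdivide[OF d1]]]]) (simp, simp add: algebra_simps)
      then show "((\<lambda>x. ?F (of_real x)) has_vector_derivative of_real (1 - u) * of_real (real n + u) powr (- s - 1))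
         (at u within {0..1})"
        by (rule has_vector_derivative_real_field)
    qed auto
    moreover have "?F (of_real 1) - ?F (of_real 0) =
      (of_nat n powr (- s) + (of_nat (Suc n) powr (1 - s) - of_nat n powr (1 - s)) / (s - 1)) / s"
      by (simp add: diff_divide_distrib add_divide_distrib algebra_simps)
    ultimately show ?thesis by simp
  qed
  have sum: "(\<Sum>n = N..<K. of_nat n powr (- s) + (of_nat (Suc n) powr (1 - s) - of_nat n powr (1 - s)) / (s - 1))
     = zsum K t + pole_term K t - zsum N t - pole_term N t"
    using assms(2)
  proof (induction K rule: dec_induct)
    case (step K)
    have "zsum (Suc K) t = zsum K t + of_nat K powr (- s)"
      using assms step unfolding zsum_eq s_def by simp
    then show ?case using step by (simp add: pole_term_def s_def[symmetric] diff_divide_distrib)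
  qed auto
  have eq: "of_real (1 - u) * tail_poly N K u t =
     (\<Sum>n = N..<K. of_real (1 - u) * of_real (real n + u) powr (- s - 1))" if u: "u \<in> {0..1}" for u
  proof -
    have "- s - 1 = Complex (- (3/2)) (- t)" by (simp add: s_def complex_eq_iff)
    then have "of_real (real n + u) powr (- s - 1) = of_real ((real n + u) powr (- (3/2))) * cis (- ln (real n + u) * t)"
      if "n \<in> {N..<K}" for n
      using that assms u of_real_powr_Complex[of "real n + u" "- (3/2)" "- t"] by (simp add: mult.commute)
    then show ?thesis unfolding dpoly_def sum_distrib_left by (intro sum.cong) auto
  qed
  have "((\<lambda>u. \<Sum>n = N..<K. of_real (1 - u) * of_real (real n + u) powr (- s - 1)) has_integral
      (\<Sum>n = N..<K. (of_nat n powr (- s) + (of_nat (Suc n) powr (1 - s) - of_nat n powr (1 - s)) / (s - 1)) / s)) {0..1}"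
    using assms by (intro has_integral_sum one) auto
  then show ?thesis
    unfolding sum_divide_distrib[symmetric] sum s_def[symmetric]
    by (rule has_integral_eq[rotated]) (use eq in auto)
qed

section \<open>The weighted second moment of zeta\<close>

lemma integral_complex_of_real:
  fixes f :: "real \<Rightarrow> real"
  assumes "continuous_on {a..b} f"
  shows "integral {a..b} (\<lambda>t. of_real (f t) :: complex) = of_real (integral {a..b} f)"
  using assms by (intro integral_unique has_integral_of_real integrable_integral integrable_continuous_real)

lemma integral_weighted_cmod2:
  assumes "continuous_on {0..T} w"
  shows "of_real (integral {0..T} (\<lambda>t. w t * (cmod (dpoly A a u t))\<^sup>2)) =
    integral {0..T} (\<lambda>t. of_real (w t) * (dpoly A a u t * cnj (dpoly A a u t)))"
proof -
  have "continuous_on {0..T} (\<lambda>t. w t * (cmod (dpoly A a u t))\<^sup>2)"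
    by (intro continuous_intros assms)
  from integral_complex_of_real[OF this] show ?thesis
    by (simp add: complex_norm_square[symmetric])
qed

lemma sum_inverse_approx:
  assumes "1 \<le> N"
  shows "\<bar>(\<Sum>n = 1..<N. 1 / real n) - ln (real N)\<bar> \<le> 1"
proof -
  have "ln (real N) \<le> (\<Sum>n = 1..<N. 1 / real n) \<and> (\<Sum>n = 1..<N. 1 / real n) \<le> ln (real N) + 1 - 1 / real N"
    using assms
  proof (induction N rule: dec_induct)
    case (step N)
    have a: "ln (real (Suc N)) - ln (real N) \<le> 1 / real N"
      using ln_le_minus_one[of "real (Suc N) / real N"] step by (simp add: ln_div field_simps)
    have b: "1 / real (Suc N) \<le> ln (real (Suc N)) - ln (real N)"
      using ln_le_minus_one[of "real N / real (Suc N)"] step by (simp add: ln_div field_simps)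
    show ?case using step a b by simp
  qed auto
  moreover have "1 / real N \<ge> 0" by simp
  ultimately show ?thesis by linarith
qed

text \<open>The diagonal \<open>\<Sum>n<N. 1/n\<close> times the moment \<open>y\<^sup>2 / 4\<close> of the weight is the main term.
  The off-diagonal terms contribute \<open>O(y\<^sup>2)\<close> because \<open>N\<close> is comparable with
  \<open>y\<close>.\<close>

lemma zsum_mean_square:
  assumes c: "cutoff y T" and N: "y \<le> real N" "real N \<le> 2 * y"
  shows "\<bar>integral {0..T} (\<lambda>t. t * exp (- (2 / y) * t) * (cmod (zsum N t))\<^sup>2) - y\<^sup>2 * ln y / 4\<bar> \<le> 75 * y\<^sup>2"
proof -
  have y: "1 \<le> y" using c by (simp add: cutoff_def)
  have N1: "1 \<le> N" using N y by linarith
  let ?a = "\<lambda>n. real n powr (- (1/2))"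
  let ?I = "integral {0..T} (\<lambda>t. t * exp (- (2 / y) * t) * (cmod (zsum N t))\<^sup>2)"
  define H where "H = (\<Sum>n = 1..<N. 1 / real n)"
  define k where "k = laplace_moment 1 T (of_real (2 / y))"
  have sq: "(\<Sum>n = 1..<N. (?a n)\<^sup>2) = H"
    unfolding H_def by (intro sum.cong refl) (simp add: powr_power powr_minus field_simps)
  have "cmod (of_real ?I - of_real H * k) \<le>
     8 * y powr (1/2) * (\<Sum>n = 1..<N. real N * ?a n) + y * (\<Sum>n = 1..<N. ?a n)\<^sup>2"
  proof -
    have off: "?a m * ?a n * (real n + 0) powr (3/2) \<le> real N * ?a m"
      if "m \<in> {1..<N}" "n \<in> {1..<N}" for m n
    proof -
      have "?a n * (real n + 0) powr (3/2) = real n"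
        using that by (simp add: powr_add[symmetric])
      then have "?a m * ?a n * (real n + 0) powr (3/2) = ?a m * real n" by (simp only: mult.assoc)
      also have "\<dots> \<le> ?a m * real N" using that by (intro mult_left_mono) auto
      finally show ?thesis by (simp add: mult.commute)
    qed
    have "of_real ?I = integral {0..T} (\<lambda>t. of_real (t ^ 1 * exp (- (2 / y) * t)) * (zsum N t * cnj (zsum N t)))"
      using integral_weighted_cmod2[of T "\<lambda>t. t ^ 1 * exp (- (2 / y) * t)" "{1..<N}" ?a 0]
      by (simp only: power_one_right continuous_intros of_nat_1 mult_1)
    moreover have "cmod (integral {0..T} (\<lambda>t. of_real (t ^ 1 * exp (- (2 / y) * t)) * (zsum N t * cnj (zsum N t)))
        - of_real (\<Sum>n = 1..<N. (?a n)\<^sup>2) * k) \<le>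
      8 * y powr (1/2) * (\<Sum>n = 1..<N. real N * ?a n) + y * (\<Sum>n = 1..<N. ?a n)\<^sup>2"
      unfolding k_def
    proof (rule dpoly_mean_square[OF c])
      show "?a m * ?a n * (real n + 0) powr (3/2) \<le> real N * ?a m"
        if "m \<in> {1..<N}" "n \<in> {1..<N}" "m < n" for m n
        using off that(1,2) by blast
    qed (use y in \<open>auto simp: divide_right_mono\<close>)
    ultimately show ?thesis unfolding sq by simp
  qed
  also have "\<dots> \<le> 8 * y powr (1/2) * (real N * (2 * sqrt (real N))) + y * (2 * sqrt (real N))\<^sup>2"
    unfolding sum_distrib_left[symmetric] using y
    by (intro add_mono mult_left_mono power_mono sum_powr_half_le sum_nonneg) auto
  also have "\<dots> \<le> 8 * sqrt y * (2 * y * (2 * sqrt (4 * y))) + y * (4 * (2 * y))"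
    using y N
    by (intro add_mono mult_mono real_sqrt_le_mono) (auto simp: powr_half_sqrt power_mult_distrib)
  also have "\<dots> = 72 * y\<^sup>2"
    using y by (simp add: real_sqrt_mult power2_eq_square)
  finally have 1: "cmod (of_real ?I - of_real H * k) \<le> 72 * y\<^sup>2" .
  have "ln (real N) \<le> ln (2 * y)" "ln y \<le> ln (real N)" using N y by auto
  moreover have "ln (2 * y) \<le> 1 + ln y"
    using ln_2_less_1 y by (simp add: ln_mult)
  ultimately have H: "\<bar>H - ln y\<bar> \<le> 2"
    using sum_inverse_approx[OF N1] unfolding H_def[symmetric] by linarith
  have H2: "\<bar>H\<bar> \<le> 2 * y" using H ln_le_minus_one[of y] ln_ge_zero[of y] y by linarith
  have "cmod (k - of_real (y\<^sup>2 / 4)) \<le> y"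
  proof -
    have "1 / (of_real (2 / y))\<^sup>2 = (of_real (y\<^sup>2 / 4) :: complex)"
      using y by (simp add: field_simps power2_eq_square)
    moreover have "1 / y \<le> Re (of_real (2 / y))" using y by (simp add: divide_right_mono)
    ultimately show ?thesis
      using laplace_moment_1_approx[OF c, of "of_real (2 / y)"] unfolding k_def by (simp only:)
  qed
  then have "cmod (of_real H * (k - of_real (y\<^sup>2 / 4))) \<le> 2 * y * y"
    unfolding norm_mult using H2 y by (intro mult_mono) auto
  then have 2: "cmod (of_real H * k - of_real (H * (y\<^sup>2 / 4))) \<le> 2 * y\<^sup>2"
    by (simp add: algebra_simps power2_eq_square)
  have "cmod (of_real (H * (y\<^sup>2 / 4)) - of_real (ln y * (y\<^sup>2 / 4))) = \<bar>H - ln y\<bar> * (y\<^sup>2 / 4)"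
    by (simp only: of_real_diff[symmetric] norm_of_real left_diff_distrib[symmetric] abs_mult) simp
  also have "\<dots> \<le> 2 * (y\<^sup>2 / 4)" using H by (intro mult_right_mono) auto
  finally have 3: "cmod (of_real (H * (y\<^sup>2 / 4)) - of_real (ln y * (y\<^sup>2 / 4))) \<le> y\<^sup>2 / 2" by simp
  have "cmod (of_real ?I - of_real (ln y * (y\<^sup>2 / 4))) \<le> 72 * y\<^sup>2 + 2 * y\<^sup>2 + y\<^sup>2 / 2"
    using 1 2 3 by (intro norm_diff_triangle_le) auto
  then have "\<bar>?I - ln y * (y\<^sup>2 / 4)\<bar> \<le> 72 * y\<^sup>2 + 2 * y\<^sup>2 + y\<^sup>2 / 2"
    by (simp only: of_real_diff[symmetric] norm_of_real)
  also have "\<dots> \<le> 75 * y\<^sup>2" by simp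
  finally show ?thesis by (simp add: mult.commute)
qed

text \<open>The coefficients \<open>n powr (- (3/2))\<close> with \<open>n \<ge> y\<close> offset the size \<open>y\<^sup>2\<close> of
  the moment of the weight.  The exponential decays at half the rate of the weight in the main
  integral; the other half is used to absorb the factor \<open>\<bar>s\<bar>\<^sup>2\<close> in front of the block.\<close>

lemma tail_poly_mean_square:
  assumes c: "cutoff y T" and N: "y \<le> real N" and u: "0 \<le> u"
  shows "integral {0..T} (\<lambda>t. t * exp (- (1 / y) * t) * (cmod (tail_poly N K u t))\<^sup>2) \<le> 56"
proof -
  have y: "1 \<le> y" using c by (simp add: cutoff_def)
  have N1: "1 \<le> N" using N y by linarith
  let ?a = "\<lambda>n. (real n + u) powr (- (3/2))"
  let ?I = "integral {0..T} (\<lambda>t. t * exp (- (1 / y) * t) * (cmod (tail_poly N K u t))\<^sup>2)"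
  define k where "k = laplace_moment 1 T (of_real (1 / y))"
  have "(\<Sum>n = N..<K. (u + real n) powr (- (3/2))) \<le> 4 * (u + real N) powr (- (1/2))"
    using N1 u by (intro sum_powr_three_halves_le) auto
  also have "\<dots> \<le> 4 * y powr (- (1/2))" using u N y by (intro mult_left_mono powr_mono2') auto
  finally have sa: "(\<Sum>n = N..<K. ?a n) \<le> 4 * y powr (- (1/2))" by (simp add: add.commute)
  have "(\<Sum>n = N..<K. (?a n)\<^sup>2) \<le> (\<Sum>n = N..<K. y powr (- (3/2)) * ?a n)"
    unfolding power2_eq_square using u N y
    by (intro sum_mono mult_right_mono powr_mono2') (auto intro: order.trans[OF N])
  also have "\<dots> \<le> y powr (- (3/2)) * (4 * y powr (- (1/2)))"
    unfolding sum_distrib_left[symmetric] using sa by (intro mult_left_mono) auto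
  also have "\<dots> = 4 / y\<^sup>2" using y by (simp add: powr_add[symmetric] powr_minus powr_numeral field_simps)
  finally have sq: "(\<Sum>n = N..<K. (?a n)\<^sup>2) \<le> 4 / y\<^sup>2" .
  have "cmod (of_real ?I - of_real (\<Sum>n = N..<K. (?a n)\<^sup>2) * k) \<le>
     8 * y powr (1/2) * (\<Sum>n = N..<K. ?a n) + y * (\<Sum>n = N..<K. ?a n)\<^sup>2"
  proof -
    have off: "?a m * ?a n * (real n + u) powr (3/2) \<le> ?a m"
      if "m \<in> {N..<K}" "n \<in> {N..<K}" for m n
    proof -
      have "?a n * (real n + u) powr (3/2) = 1"
        using that N1 u by (simp add: powr_add[symmetric])
      then show ?thesis by (simp only: mult.assoc mult_1_right order_refl)
    qed
    have "of_real ?I = integral {0..T} (\<lambda>t. of_real (t ^ 1 * exp (- (1 / y) * t)) * (tail_poly N K u t * cnj (tail_poly N K u t)))"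
      using integral_weighted_cmod2[of T "\<lambda>t. t ^ 1 * exp (- (1 / y) * t)" "{N..<K}" ?a u]
      by (simp only: power_one_right continuous_intros)
    moreover have "cmod (integral {0..T} (\<lambda>t. of_real (t ^ 1 * exp (- (1 / y) * t)) *
          (tail_poly N K u t * cnj (tail_poly N K u t))) - of_real (\<Sum>n = N..<K. (?a n)\<^sup>2) * k) \<le>
      8 * y powr (1/2) * (\<Sum>n = N..<K. ?a n) + y * (\<Sum>n = N..<K. ?a n)\<^sup>2"
      unfolding k_def
    proof (rule dpoly_mean_square[OF c])
      show "?a m * ?a n * (real n + u) powr (3/2) \<le> ?a m"
        if "m \<in> {N..<K}" "n \<in> {N..<K}" "m < n" for m n
        using off that(1,2) by blast
    qed (use y N1 u in auto)
    ultimately show ?thesis by simp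
  qed
  also have "\<dots> \<le> 8 * y powr (1/2) * (4 * y powr (- (1/2))) + y * (4 * y powr (- (1/2)))\<^sup>2"
    using sa y by (intro add_mono mult_left_mono power_mono sum_nonneg) auto
  also have "\<dots> = 48"
    using y by (simp add: power_mult_distrib powr_power powr_add[symmetric] powr_minus field_simps)
  finally have 1: "cmod (of_real ?I - of_real (\<Sum>n = N..<K. (?a n)\<^sup>2) * k) \<le> 48" .
  have "cmod k \<le> cmod (1 / (of_real (1 / y))\<^sup>2 :: complex) + y"
    using laplace_moment_1_approx[OF c, of "of_real (1 / y)"]
      norm_triangle_ineq2[of k "1 / (of_real (1 / y))\<^sup>2"] unfolding k_def by simp
  also have "\<dots> \<le> 2 * y\<^sup>2"
    using y self_le_power[of y 2] by (simp add: norm_divide norm_power power_divide)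
  finally have "cmod (of_real (\<Sum>n = N..<K. (?a n)\<^sup>2) * k) \<le> 4 / y\<^sup>2 * (2 * y\<^sup>2)"
    unfolding norm_mult norm_of_real using sq y by (intro mult_mono) (auto simp: sum_nonneg)
  then have "cmod (of_real (\<Sum>n = N..<K. (?a n)\<^sup>2) * k) \<le> 8" using y by simp
  then have "cmod (of_real ?I) \<le> 56"
    using 1 norm_triangle_ineq2[of "of_real ?I" "of_real (\<Sum>n = N..<K. (?a n)\<^sup>2) * k"] by linarith
  then show ?thesis by simp
qed

lemma integral_01_square_le:
  fixes f :: "real \<Rightarrow> real"
  assumes "continuous_on {0..1} f"
  shows "(integral {0..1} f)\<^sup>2 \<le> integral {0..1} (\<lambda>u. (f u)\<^sup>2)"
proof -
  define q where "q = integral {0..1} f"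
  have i: "f integrable_on {0..1}" "(\<lambda>u. (f u)\<^sup>2) integrable_on {0..1}"
    using assms by (auto intro!: integrable_continuous_real continuous_intros)
  have "((\<lambda>u. (f u)\<^sup>2 - 2 * q * f u + q\<^sup>2) has_integral
      (integral {0..1} (\<lambda>u. (f u)\<^sup>2) - 2 * q * q + q\<^sup>2 * (1 - 0))) {0..1}"
    unfolding q_def using has_integral_const_real[of "q\<^sup>2" 0 1]
    by (intro has_integral_add has_integral_diff has_integral_mult_right integrable_integral i)
      (simp add: q_def)
  then have "0 \<le> integral {0..1} (\<lambda>u. (f u)\<^sup>2) - 2 * q * q + q\<^sup>2 * (1 - 0)"
  proof (rule has_integral_nonneg)
    fix u
    have "(f u)\<^sup>2 - 2 * q * f u + q\<^sup>2 = (f u - q)\<^sup>2" by (simp add: power2_eq_square algebra_simps)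
    then show "0 \<le> (f u)\<^sup>2 - 2 * q * f u + q\<^sup>2" by simp
  qed
  then show ?thesis by (simp add: q_def power2_eq_square)
qed

lemma swap_unit_interval:
  fixes f :: "real \<Rightarrow> real \<Rightarrow> 'c :: banach"
  assumes "continuous_on ({0..T} \<times> {0..1}) (\<lambda>(t, u). f t u)"
  shows "integral {0..T} (\<lambda>t. integral {0..1} (f t)) = integral {0..1} (\<lambda>u. integral {0..T} (\<lambda>t. f t u))"
  using integral_swap_continuous[of 0 0 T 1 f] assms by (simp add: cbox_Pair_eq)

lemma norm_integral_unit_le:
  fixes f :: "real \<Rightarrow> 'c :: banach"
  assumes "\<And>u. u \<in> {0..1} \<Longrightarrow> norm (f u) \<le> B"
  shows "norm (integral {0..1} f) \<le> B"
proof (cases "f integrable_on {0..1}")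
  case True
  then have "(f has_integral integral {0..1} f) (cbox 0 1)" by (simp add: integrable_integral)
  then have "norm (integral {0..1} f) \<le> B * measure lborel (cbox 0 (1::real))"
    using assms order.trans[OF norm_ge_zero assms[of 0]] by (intro has_integral_bound) auto
  then show ?thesis by simp
next
  case False
  then show ?thesis using order.trans[OF norm_ge_zero assms[of 0]] by (simp add: not_integrable_integral)
qed

definition block :: "nat \<Rightarrow> nat \<Rightarrow> real \<Rightarrow> complex" where
  "block N K t = zsum K t + pole_term K t - zsum N t - pole_term N t"

lemma block_eq:
  assumes "1 \<le> N" "N \<le> K"
  shows "block N K t = Complex (1/2) t * integral {0..1} (\<lambda>u. of_real (1 - u) * tail_poly N K u t)"
proof -
  have "Complex (1/2) t \<noteq> 0" by (simp add: complex_eq_iff)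
  then show ?thesis using integral_unique[OF zeta_block[OF assms, of t]] by (simp add: block_def)
qed

lemma continuous_on_block [continuous_intros]:
  "1 \<le> N \<Longrightarrow> N \<le> K \<Longrightarrow> continuous_on X (block N K)"
  unfolding block_def by (intro continuous_intros) auto

lemma continuous_on_tail_poly_u:
  assumes "1 \<le> N" shows "continuous_on {0..1} (\<lambda>u. tail_poly N K u t)"
proof -
  have "continuous_on {0..1} ((\<lambda>(t, u). tail_poly N K u t) \<circ> (\<lambda>u. (t, u)))"
    by (intro continuous_on_compose continuous_intros
      continuous_on_subset[OF tail_poly_jointly_continuous[OF assms, of "{t}"]]) auto
  then show ?thesis by (simp add: o_def)
qed

text \<open>Part of the exponential weight pays for \<open>\<bar>s\<bar>\<^sup>2 = 1/4 + t\<^sup>2\<close> at a cost of \<open>y\<^sup>2\<close>;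
  what remains is an average over \<open>u\<close> of bounded mean squares.\<close>

lemma block_mean_square:
  assumes c: "cutoff y T" and N: "y \<le> real N" "N \<le> K"
  shows "integral {0..T} (\<lambda>t. t * exp (- (2 / y) * t) * (cmod (block N K t))\<^sup>2) \<le> 126 * y\<^sup>2"
proof -
  have y: "1 \<le> y" using c by (simp add: cutoff_def)
  have N1: "1 \<le> N" using N y by linarith
  let ?f = "\<lambda>t u. t * exp (- (1 / y) * t) * (cmod (tail_poly N K u t))\<^sup>2"
  have cf: "continuous_on ({0..T} \<times> {0..1}) (\<lambda>(t, u). ?f t u)"
    using tail_poly_jointly_continuous[OF N1, of "{0..T}" K]
    unfolding case_prod_beta by (intro continuous_intros)
  have pt: "t * exp (- (2 / y) * t) * (cmod (block N K t))\<^sup>2 \<le> 9/4 * y\<^sup>2 * integral {0..1} (?f t)"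
    if t: "t \<in> {0..T}" for t
  proof -
    let ?D = "\<lambda>u. tail_poly N K u t"
    let ?q = "integral {0..1} (\<lambda>u. (cmod (?D u))\<^sup>2)"
    note cD = continuous_on_tail_poly_u[OF N1, of K t]
    have q0: "0 \<le> ?q" by (rule integral_nonneg) (auto intro!: integrable_continuous_real continuous_intros cD)
    have "cmod (integral {0..1} (\<lambda>u. of_real (1 - u) * ?D u)) \<le> integral {0..1} (\<lambda>u. cmod (?D u))"
    proof (rule integral_norm_bound_integral)
      fix u :: real assume u: "u \<in> {0..1}"
      have "cmod (of_real (1 - u) * ?D u) = \<bar>1 - u\<bar> * cmod (?D u)"
        by (simp only: norm_mult norm_of_real)
      also have "\<dots> \<le> 1 * cmod (?D u)" using u by (intro mult_right_mono) auto
      finally show "cmod (of_real (1 - u) * ?D u) \<le> cmod (?D u)" by simp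
    qed (auto intro!: integrable_continuous_real continuous_intros cD)
    then have "(cmod (integral {0..1} (\<lambda>u. of_real (1 - u) * ?D u)))\<^sup>2 \<le> (integral {0..1} (\<lambda>u. cmod (?D u)))\<^sup>2"
      by (intro power_mono) auto
    also have "\<dots> \<le> ?q" by (intro integral_01_square_le continuous_intros cD)
    finally have "(cmod (block N K t))\<^sup>2 \<le> (cmod (Complex (1/2) t))\<^sup>2 * ?q"
      unfolding block_eq[OF N1 N(2)] norm_mult power_mult_distrib by (intro mult_left_mono) auto
    also have "(cmod (Complex (1/2) t))\<^sup>2 = 1/4 + t\<^sup>2" by (simp add: cmod_power2 power_divide)
    also have "\<dots> \<le> 9/4 * y\<^sup>2 * exp (1 / y * t)"
    proof -
      have "1 + 1 / y * t + (1 / y * t)\<^sup>2 / 2 \<le> exp (1 / y * t)"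
        using t y by (intro exp_lower_Taylor_quadratic) auto
      then have "9/4 * y\<^sup>2 * (1 + 1 / y * t + (1 / y * t)\<^sup>2 / 2) \<le> 9/4 * y\<^sup>2 * exp (1 / y * t)"
        by (intro mult_left_mono) auto
      moreover have "9/4 * y\<^sup>2 * (1 + 1 / y * t + (1 / y * t)\<^sup>2 / 2) = 9/4 * y\<^sup>2 + 9/4 * y * t + 9/8 * t\<^sup>2"
        using y by (simp add: field_simps power2_eq_square)
      moreover have "1 \<le> y\<^sup>2" "0 \<le> y * t" "0 \<le> t\<^sup>2" using y t by auto
      ultimately show ?thesis by linarith
    qed
    finally have "(cmod (block N K t))\<^sup>2 \<le> 9/4 * y\<^sup>2 * exp (1 / y * t) * ?q"
      using q0 by (simp add: mult_right_mono)
    then have "t * exp (- (2 / y) * t) * (cmod (block N K t))\<^sup>2 \<le>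
        t * exp (- (2 / y) * t) * (9/4 * y\<^sup>2 * exp (1 / y * t) * ?q)"
      using t by (intro mult_left_mono) auto
    also have "\<dots> = 9/4 * y\<^sup>2 * (t * (exp (- (2 / y) * t) * exp (1 / y * t)) * ?q)"
      by (simp add: mult_ac)
    also have "exp (- (2 / y) * t) * exp (1 / y * t) = exp (- (1 / y) * t)"
      by (simp add: exp_add[symmetric] field_simps)
    finally show ?thesis by simp
  qed
  have cF: "continuous_on {0..T} (\<lambda>t. integral {0..1} (?f t))"
    using integral_continuous_on_param[of "{0..T}" 0 1 ?f] cf by simp
  have "integral {0..T} (\<lambda>t. t * exp (- (2 / y) * t) * (cmod (block N K t))\<^sup>2) \<le>
      integral {0..T} (\<lambda>t. 9/4 * y\<^sup>2 * integral {0..1} (?f t))"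
    using pt N1 N cF y by (intro integral_le integrable_continuous_real continuous_intros) auto
  also have "\<dots> = 9/4 * y\<^sup>2 * integral {0..1} (\<lambda>u. integral {0..T} (\<lambda>t. ?f t u))"
    unfolding swap_unit_interval[OF cf, symmetric] using y by simp
  also have "\<dots> \<le> 9/4 * y\<^sup>2 * 56"
  proof (rule mult_left_mono)
    have "norm (integral {0..1} (\<lambda>u. integral {0..T} (\<lambda>t. ?f t u))) \<le> 56"
    proof (rule norm_integral_unit_le)
      fix u :: real assume u: "u \<in> {0..1}"
      have "0 \<le> integral {0..T} (\<lambda>t. ?f t u)"
        using y by (intro integral_nonneg) (auto intro!: integrable_continuous_real continuous_intros)
      then show "norm (integral {0..T} (\<lambda>t. ?f t u)) \<le> 56"
        using tail_poly_mean_square[OF c N(1), of u K] u by simp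
    qed
    then show "integral {0..1} (\<lambda>u. integral {0..T} (\<lambda>t. ?f t u)) \<le> 56" by simp
  qed simp
  finally show ?thesis by simp
qed

text \<open>This is the term that Cauchy-Schwarz would estimate too generously: it would lose the square root
  of \<open>ln y\<close>.  After exchanging the integrals over \<open>t\<close> and \<open>u\<close>, the separation of the
  frequencies of the two Dirichlet polynomials gives \<open>O(y\<^sup>2)\<close>.  The factor
  \<open>s = 1/2 + \<i> * t\<close> combines with the weight into the first and second moments.\<close>

lemma zsum_block_cross:
  assumes c: "cutoff y T" and N: "y \<le> real N" "real N \<le> 2 * y" "N \<le> K"
  shows "\<bar>integral {0..T} (\<lambda>t. t * exp (- (2 / y) * t) * Re (block N K t * cnj (zsum N t)))\<bar> \<le> 42 * y\<^sup>2"
proof -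
  have y: "1 \<le> y" using c by (simp add: cutoff_def)
  have N1: "1 \<le> N" using N y by linarith
  have y2: "1 / y \<le> 2 / y" using y by (simp add: divide_right_mono)
  let ?P = "\<lambda>t u. tail_poly N K u t * cnj (zsum N t)"
  let ?w = "\<lambda>t. complex_of_real (t * exp (- (2 / y) * t))"
  let ?G = "\<lambda>t u. of_real (1 - u) * (?w t * (Complex (1/2) t * ?P t u))"
  let ?X = "\<lambda>k u. integral {0..T} (\<lambda>t. of_real (t ^ k * exp (- (2 / y) * t)) * ?P t u)"
  have sq: "sqrt (real N) \<le> 3/2 * sqrt y"
  proof -
    have "sqrt (real N) \<le> sqrt ((3/2)\<^sup>2 * y)"
      using N y by (intro real_sqrt_le_mono) (simp add: power_divide)
    then show ?thesis by (simp add: real_sqrt_mult)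
  qed
  have moment_le: "cmod (laplace_moment 1 T (Complex (2 / y) l)) \<le> y powr (1/2) * (b powr (3/2) * (b - a) powr (- (3/2))) + y"
    "cmod (laplace_moment 2 T (Complex (2 / y) l)) \<le> 2 * y powr (3/2) * (b powr (3/2) * (b - a) powr (- (3/2))) + y\<^sup>2"
    if "0 < a" "a < b" "l = ln b - ln a" for a b l
    using laplace_moment_le[OF c y2, of a b l] that by auto
  have X1: "cmod (?X 1 u) \<le> 20 * y" if u: "0 \<le> u" for u
  proof -
    have "cmod (?X 1 u) \<le> 8 * y powr (1/2) * sqrt (real N) + 8 * y"
      using y by (intro dpoly_cross[OF u N1] moment_le) auto
    also have "\<dots> \<le> 8 * y powr (1/2) * (3/2 * sqrt y) + 8 * y"
      using sq by (intro add_right_mono mult_left_mono) auto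
    finally show ?thesis using y by (simp add: powr_half_sqrt)
  qed
  have X2: "cmod (?X 2 u) \<le> 32 * y\<^sup>2" if u: "0 \<le> u" for u
  proof -
    have "cmod (?X 2 u) \<le> 8 * (2 * y powr (3/2)) * sqrt (real N) + 8 * y\<^sup>2"
      using y by (intro dpoly_cross[OF u N1] moment_le) auto
    also have "\<dots> \<le> 8 * (2 * y powr (3/2)) * (3/2 * sqrt y) + 8 * y\<^sup>2"
      using sq by (intro add_right_mono mult_left_mono) auto
    also have "y powr (3/2) = y * sqrt y"
      using y powr_add[of y 1 "1/2"] by (simp add: powr_half_sqrt)
    finally show ?thesis using y by (simp add: power2_eq_square)
  qed
  have contG: "continuous_on ({0..T} \<times> {0..1}) (\<lambda>(t, u). ?G t u)"
  proof -
    have "continuous_on ({0..T} \<times> {0..1}) (\<lambda>x. zsum N (fst x))"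
      by (rule continuous_on_compose2[OF continuous_on_dpoly[of UNIV]]) (auto intro!: continuous_intros)
    then show ?thesis
      using tail_poly_jointly_continuous[OF N1, of "{0..T}" K]
      unfolding case_prod_beta Complex_eq by (intro continuous_intros)
  qed
  have int_u: "?w t * (block N K t * cnj (zsum N t)) = integral {0..1} (?G t)" for t
  proof -
    have "?G t = (\<lambda>u. (?w t * Complex (1/2) t * cnj (zsum N t)) * (of_real (1 - u) * tail_poly N K u t))"
      by (simp add: fun_eq_iff mult_ac)
    then have h: "(?G t has_integral (?w t * Complex (1/2) t * cnj (zsum N t)) * (block N K t / Complex (1/2) t)) {0..1}"
      by (simp only:) (rule has_integral_mult_right[OF zeta_block[OF N1 N(3), folded block_def]])
    have "Complex (1/2) t \<noteq> 0" by (simp add: complex_eq_iff)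
    then show ?thesis unfolding integral_unique[OF h] by simp
  qed
  have int_t: "cmod (integral {0..T} (\<lambda>t. ?G t u)) \<le> 42 * y\<^sup>2" if u: "u \<in> {0..1}" for u
  proof -
    have G: "?G t u = of_real (1 - u) * (1/2 * (of_real (t ^ 1 * exp (- (2 / y) * t)) * ?P t u) +
         \<i> * (of_real (t ^ 2 * exp (- (2 / y) * t)) * ?P t u))" for t
      by (simp add: Complex_eq power2_eq_square algebra_simps)
    have i: "(\<lambda>t. of_real (t ^ k * exp (- (2 / y) * t)) * ?P t u) integrable_on {0..T}" for k
      using y by (intro integrable_continuous_real continuous_intros) auto
    have "((\<lambda>t. ?G t u) has_integral of_real (1 - u) * (1/2 * ?X 1 u + \<i> * ?X 2 u)) {0..T}"
      unfolding G by (intro has_integral_mult_right has_integral_add integrable_integral i)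
    then have "cmod (integral {0..T} (\<lambda>t. ?G t u)) = \<bar>1 - u\<bar> * cmod (1/2 * ?X 1 u + \<i> * ?X 2 u)"
      by (simp only: integral_unique norm_mult norm_of_real)
    also have "\<dots> \<le> 1 * (1/2 * (20 * y) + 32 * y\<^sup>2)"
      using u X1[of u] X2[of u]
      by (intro mult_mono norm_triangle_le) (auto simp: norm_mult)
    also have "\<dots> \<le> 42 * y\<^sup>2" using y self_le_power[of y 2] by simp
    finally show ?thesis .
  qed
  have "integral {0..T} (\<lambda>t. ?w t * (block N K t * cnj (zsum N t))) = integral {0..1} (\<lambda>u. integral {0..T} (\<lambda>t. ?G t u))"
    unfolding int_u by (rule swap_unit_interval[OF contG])
  then have bound: "cmod (integral {0..T} (\<lambda>t. ?w t * (block N K t * cnj (zsum N t)))) \<le> 42 * y\<^sup>2"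
    using norm_integral_unit_le[OF int_t] by simp
  have "(\<lambda>t. ?w t * (block N K t * cnj (zsum N t))) integrable_on {0..T}"
    using y N1 N by (intro integrable_continuous_real continuous_intros) auto
  from integral_linear[OF this bounded_linear_Re]
  have "integral {0..T} (\<lambda>t. t * exp (- (2 / y) * t) * Re (block N K t * cnj (zsum N t))) =
     Re (integral {0..T} (\<lambda>t. ?w t * (block N K t * cnj (zsum N t))))"
    by (simp add: o_def)
  then show ?thesis using order.trans[OF abs_Re_le_cmod bound] by (simp only:)
qed

lemma integral_exp_decay_le:
  fixes y T :: real
  assumes "0 < y" "0 \<le> T"
  shows "integral {0..T} (\<lambda>t. exp (- (2 / y) * t)) \<le> y / 2"
proof -
  have "((\<lambda>t. exp (- (2 / y) * t)) has_integral (- (y / 2) * exp (- (2 / y) * T) - (- (y / 2) * exp (- (2 / y) * 0)))) {0..T}"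
    using assms by (intro fundamental_theorem_of_calculus)
      (auto intro!: derivative_eq_intros simp flip: has_real_derivative_iff_has_vector_derivative)
  then show ?thesis using assms by (simp add: integral_unique)
qed

lemma cmod_add_square:
  "(cmod (a + b))\<^sup>2 = (cmod a)\<^sup>2 + 2 * Re (b * cnj a) + (cmod b)\<^sup>2"
  unfolding cmod_power2 by (simp add: power2_eq_square algebra_simps)

lemma cmod_sum3_square_le:
  "(cmod (a + b + c))\<^sup>2 \<le> 3 * ((cmod a)\<^sup>2 + (cmod b)\<^sup>2 + (cmod c)\<^sup>2)"
proof -
  have "(cmod (a + b + c))\<^sup>2 \<le> (cmod a + cmod b + cmod c)\<^sup>2"
    by (intro power_mono order.trans[OF norm_triangle_ineq] add_right_mono norm_triangle_ineq) auto
  also have "\<dots> \<le> 3 * ((cmod a)\<^sup>2 + (cmod b)\<^sup>2 + (cmod c)\<^sup>2)"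
    using zero_le_power2[of "cmod a - cmod b"] zero_le_power2[of "cmod b - cmod c"] zero_le_power2[of "cmod a - cmod c"]
    by (simp add: power2_eq_square algebra_simps)
  finally show ?thesis .
qed

abbreviation zeta_sq :: "real \<Rightarrow> real" where
  "zeta_sq t \<equiv> (cmod (zeta (Complex (1/2) t)))\<^sup>2"

text \<open>Write zeta as \<open>S + A + R + E\<close>: the sum up to \<open>N \<approx> y\<close>, the pole term, the block from
  \<open>N\<close> to \<open>K\<close>, and the truncation error.  The square of \<open>S\<close> gives the main term, and its
  product with \<open>R\<close> is small by the separation of frequencies.  The pole term is only large near
  \<open>t = 0\<close>, where the weight vanishes, so pointwise bounds suffice for it; \<open>E\<close> is made as small
  as required by the choice of \<open>K\<close>.\<close>

theorem weighted_second_moment: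
  assumes c: "cutoff y T"
  shows "\<bar>integral {0..T} (\<lambda>t. t * exp (- (2 / y) * t) * zeta_sq t) - y\<^sup>2 * ln y / 4\<bar> \<le> 550 * y\<^sup>2"
proof -
  have y: "1 \<le> y" "0 \<le> T" using c by (auto simp: cutoff_def)
  define N where "N = nat \<lceil>y\<rceil>"
  have N: "y \<le> real N" "real N \<le> 2 * y" using y unfolding N_def by linarith+
  have N1: "1 \<le> N" using N y by linarith
  \<comment> \<open>The truncation error is \<open>O((1 + T) / sqrt K)\<close>; this size makes its total contribution at most 1.\<close>
  define Q where "Q = 4 * (1 + T) ^ 3 * (4 * sqrt (real N) + 3)"
  define K where "K = N + nat \<lceil>Q\<^sup>2\<rceil>"
  have K: "N \<le> K" "1 \<le> K" "Q \<le> sqrt (real K)"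
  proof -
    have "Q\<^sup>2 \<le> real K" unfolding K_def by linarith
    then show "Q \<le> sqrt (real K)" by (rule real_le_rsqrt)
  qed (use N1 in \<open>auto simp: K_def\<close>)
  let ?S = "zsum N" and ?A = "pole_term N" and ?R = "block N K"
  define E where "E = (\<lambda>t. zeta (Complex (1/2) t) - zsum K t - pole_term K t)"
  let ?w = "\<lambda>t. t * exp (- (2 / y) * t)"
  define \<eta> where "\<eta> = 1 / ((1 + T)\<^sup>2 * (4 * sqrt (real N) + 3))"
  have eta: "0 \<le> \<eta>" "\<eta> \<le> 1"
  proof -
    have "1 * 1 \<le> (1 + T)\<^sup>2 * (4 * sqrt (real N) + 3)"
      using y by (intro mult_mono one_le_power) auto
    then show "0 \<le> \<eta>" "\<eta> \<le> 1" by (auto simp: \<eta>_def)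
  qed
  have E: "cmod (E t) \<le> \<eta>" if t: "t \<in> {0..T}" for t
  proof -
    have Q0: "0 < Q" using y by (auto simp: Q_def intro!: mult_pos_pos add_nonneg_pos)
    have "cmod (Complex (1/2) t) \<le> 1 + T" using cmod_le[of "Complex (1/2) t"] t by simp
    then have "4 * cmod (Complex (1/2) t) / sqrt (real K) \<le> 4 * (1 + T) / Q"
      using K Q0 y by (intro frac_le) auto
    also have "\<dots> = \<eta>"
    proof -
      have gen: "4 * p / (4 * p ^ 3 * r) = 1 / (p\<^sup>2 * r)" if "0 < p" for p r :: real
        using that by (simp add: power2_eq_square power3_eq_cube)
      show ?thesis unfolding Q_def \<eta>_def by (rule gen) (use y in simp)
    qed
    finally show ?thesis using zeta_truncation[OF K(2), of t] unfolding E_def by linarith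
  qed
  have decomp: "zeta (Complex (1/2) t) = ?S t + (?A t + ?R t + E t)" for t
    by (simp add: E_def block_def)
  have contE: "continuous_on X E" for X
    unfolding E_def using K by (intro continuous_intros) auto
  have S: "cmod (?S t) \<le> 2 * sqrt (real N)" for t
    using cmod_dpoly_le[of "{1..<N}" "\<lambda>n. real n powr (- (1/2))" 0 t] sum_powr_half_le[of N] by simp
  \<comment> \<open>What is left after subtracting the main term and the one product that needs cancellation.\<close>
  let ?D = "\<lambda>t. ?w t * (zeta_sq t - (cmod (?S t))\<^sup>2 - 2 * Re (?R t * cnj (?S t)))"
  let ?g = "\<lambda>t. 7 * real N * exp (- (2 / y) * t) + 3 * (?w t * (cmod (?R t))\<^sup>2) + T / (1 + T)\<^sup>2"
  have pt: "\<bar>?D t\<bar> \<le> ?g t" if t: "t \<in> {0..T}" for t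
  proof -
    let ?e = "exp (- (2 / y) * t)"
    have w: "0 \<le> ?w t" "?w t \<le> T"
      using t y mult_mono[of t T "?e" 1] by auto
    have "zeta_sq t - (cmod (?S t))\<^sup>2 - 2 * Re (?R t * cnj (?S t)) =
        2 * Re (?A t * cnj (?S t)) + 2 * Re (E t * cnj (?S t)) + (cmod (?A t + ?R t + E t))\<^sup>2"
      unfolding decomp cmod_add_square[of "?S t"] by (simp add: algebra_simps)
    also have "\<bar>\<dots>\<bar> \<le> 2 * (cmod (?A t) * cmod (?S t)) + 2 * (cmod (E t) * cmod (?S t)) +
        3 * ((cmod (?A t))\<^sup>2 + (cmod (?R t))\<^sup>2 + (cmod (E t))\<^sup>2)"
      using abs_Re_le_cmod[of "?A t * cnj (?S t)", unfolded norm_mult complex_mod_cnj]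
        abs_Re_le_cmod[of "E t * cnj (?S t)", unfolded norm_mult complex_mod_cnj]
        cmod_sum3_square_le[of "?A t" "?R t" "E t"] zero_le_power2[of "cmod (?A t + ?R t + E t)"]
      by linarith
    also have "\<dots> \<le> 2 * (cmod (?A t) * (2 * sqrt (real N))) + 2 * (\<eta> * (2 * sqrt (real N))) +
        3 * ((cmod (?A t))\<^sup>2 + (cmod (?R t))\<^sup>2 + \<eta> * 1)"
    proof -
      have "(cmod (E t))\<^sup>2 \<le> \<eta> * 1"
        unfolding power2_eq_square using E[OF t] eta by (intro mult_mono) auto
      then show ?thesis
        using E[OF t] eta S[of t] by (intro add_mono mult_left_mono mult_mono) auto
    qed
    also have "\<dots> = (4 * sqrt (real N) * cmod (?A t) + 3 * (cmod (?A t))\<^sup>2) + 3 * (cmod (?R t))\<^sup>2 + \<eta> * (4 * sqrt (real N) + 3)"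
      by (simp add: algebra_simps)
    also have "\<eta> * (4 * sqrt (real N) + 3) = 1 / (1 + T)\<^sup>2"
      using y by (simp add: \<eta>_def add_nonneg_eq_0_iff)
    finally have "\<bar>?D t\<bar> \<le> ?w t * ((4 * sqrt (real N) * cmod (?A t) + 3 * (cmod (?A t))\<^sup>2) + 3 * (cmod (?R t))\<^sup>2 + 1 / (1 + T)\<^sup>2)"
      unfolding abs_mult[of "?w t"] abs_of_nonneg[OF w(1)] by (rule mult_left_mono[OF _ w(1)])
    also have "\<dots> = ?e * (t * (4 * sqrt (real N) * cmod (?A t) + 3 * (cmod (?A t))\<^sup>2)) + 3 * (?w t * (cmod (?R t))\<^sup>2) + ?w t * (1 / (1 + T)\<^sup>2)"
      by (simp add: algebra_simps)
    also have "\<dots> \<le> ?e * (7 * real N) + 3 * (?w t * (cmod (?R t))\<^sup>2) + T * (1 / (1 + T)\<^sup>2)"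
    proof (intro add_mono mult_left_mono mult_right_mono w)
      have q: "t \<le> sqrt (1/4 + t\<^sup>2)" "0 < sqrt (1/4 + t\<^sup>2)"
        using real_le_rsqrt[of t "1/4 + t\<^sup>2"] by (auto simp: add_pos_nonneg)
      have "t * cmod (?A t) \<le> sqrt (real N)"
        using q N1 by (simp add: cmod_pole_term field_simps mult_left_mono)
      then have "4 * sqrt (real N) * (t * cmod (?A t)) \<le> 4 * sqrt (real N) * sqrt (real N)"
        by (intro mult_left_mono) auto
      moreover have "t * (cmod (?A t))\<^sup>2 \<le> real N"
      proof -
        have "t \<le> 1/4 + t\<^sup>2" using zero_le_power2[of "t - 1/2"] by (simp add: power2_eq_square algebra_simps)
        then have "real N * t \<le> real N * (1/4 + t\<^sup>2)" by (intro mult_left_mono) auto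
        moreover have "t * (cmod (?A t))\<^sup>2 = real N * t / (1/4 + t\<^sup>2)"
          using N1 by (simp add: cmod_pole_term power_divide)
        moreover have "0 < 1/4 + t\<^sup>2" by (simp add: add_pos_nonneg)
        ultimately show ?thesis by (simp add: divide_le_eq)
      qed
      ultimately show "t * (4 * sqrt (real N) * cmod (?A t) + 3 * (cmod (?A t))\<^sup>2) \<le> 7 * real N"
        by (simp add: algebra_simps)
    qed auto
    finally show ?thesis by (simp add: mult_ac)
  qed
  have iS: "(\<lambda>t. ?w t * (cmod (?S t))\<^sup>2) integrable_on {0..T}"
    and iC: "(\<lambda>t. ?w t * Re (?R t * cnj (?S t))) integrable_on {0..T}"
    and iZ: "(\<lambda>t. ?w t * zeta_sq t) integrable_on {0..T}"
    and iR: "(\<lambda>t. ?w t * (cmod (?R t))\<^sup>2) integrable_on {0..T}"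
    and ie: "(\<lambda>t. exp (- (2 / y) * t)) integrable_on {0..T}"
    using y N1 K by (intro integrable_continuous_real continuous_intros; simp)+
  have D: "(?D has_integral (integral {0..T} (\<lambda>t. ?w t * zeta_sq t) - integral {0..T} (\<lambda>t. ?w t * (cmod (?S t))\<^sup>2)
      - 2 * integral {0..T} (\<lambda>t. ?w t * Re (?R t * cnj (?S t))))) {0..T}" (is "(_ has_integral ?ID) _")
  proof -
    have "?D = (\<lambda>t. ?w t * zeta_sq t - ?w t * (cmod (?S t))\<^sup>2 - 2 * (?w t * Re (?R t * cnj (?S t))))"
      by (simp add: fun_eq_iff right_diff_distrib mult_ac)
    then show ?thesis
      by (simp only:) (intro has_integral_diff has_integral_mult_right integrable_integral iS iC iZ)
  qed
  have g: "(?g has_integral (7 * real N * integral {0..T} (\<lambda>t. exp (- (2 / y) * t)) +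
      3 * integral {0..T} (\<lambda>t. ?w t * (cmod (?R t))\<^sup>2) + T / (1 + T)\<^sup>2 * (T - 0))) {0..T}" (is "(_ has_integral ?Ig) _")
    using y has_integral_const_real[of "T / (1 + T)\<^sup>2" 0 T]
    by (intro has_integral_add has_integral_mult_right integrable_integral iR ie) (simp add: mult.commute)
  have "\<bar>integral {0..T} ?D\<bar> \<le> integral {0..T} ?g"
    using integral_norm_bound_integral[of ?D "{0..T}" ?g] D g pt by (auto simp: has_integral_iff)
  then have "\<bar>?ID\<bar> \<le> ?Ig" using integral_unique[OF D] integral_unique[OF g] by simp
  moreover have "?Ig \<le> 7 * (2 * y) * (y / 2) + 3 * (126 * y\<^sup>2) + 1"
  proof (intro add_mono mult_mono mult_left_mono integral_exp_decay_le block_mean_square[OF c N(1) K(1)])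
    have "T * T \<le> (1 + T)\<^sup>2" using y by (simp add: power2_eq_square algebra_simps)
    then show "T / (1 + T)\<^sup>2 * (T - 0) \<le> 1" using y by (simp add: divide_le_eq)
    show "0 \<le> integral {0..T} (\<lambda>t. exp (- (2 / y) * t))" by (rule integral_nonneg[OF ie]) simp
    show "0 \<le> integral {0..T} (\<lambda>t. ?w t * (cmod (?R t))\<^sup>2)" by (rule integral_nonneg[OF iR]) auto
  qed (use y N in auto)
  ultimately have "\<bar>?ID\<bar> \<le> 385 * y\<^sup>2 + 1" by (simp add: power2_eq_square)
  moreover have "1 \<le> y\<^sup>2" using y by simp
  ultimately show ?thesis
    using zsum_mean_square[OF c N(1,2)] zsum_block_cross[OF c N K(1)] by linarith
qed

section \<open>Jacob's ladders\<close>

lemma cmod_hardy_Z: "cmod (hardy_Z t) = cmod (zeta (Complex (1/2) t))"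
  by (simp add: hardy_Z_def norm_mult)

lemma zeta_sq_le: "0 \<le> t \<Longrightarrow> zeta_sq t \<le> (4 + 4 * t)\<^sup>2"
proof -
  assume t: "0 \<le> t"
  have "1/2 \<le> sqrt (1/4 + t\<^sup>2)" by (rule real_le_rsqrt) (simp add: power_divide)
  then have "cmod (pole_term 1 t) \<le> 2"
    unfolding cmod_pole_term[OF order_refl] using frac_le[of 1 1 "1/2" "sqrt (1/4 + t\<^sup>2)"] by simp
  moreover have "cmod (Complex (1/2) t) \<le> 1/2 + t" using cmod_le[of "Complex (1/2) t"] t by simp
  moreover have "cmod (zeta (Complex (1/2) t) - pole_term 1 t) \<le> 4 * cmod (Complex (1/2) t)"
    using zeta_truncation[of 1 t] by (simp add: dpoly_def)
  moreover have "cmod (zeta (Complex (1/2) t)) \<le> cmod (zeta (Complex (1/2) t) - pole_term 1 t) + cmod (pole_term 1 t)"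
    using norm_triangle_ineq[of "zeta (Complex (1/2) t) - pole_term 1 t" "pole_term 1 t"] by simp
  ultimately have "cmod (zeta (Complex (1/2) t)) \<le> 4 + 4 * t" by linarith
  then show ?thesis by (intro power_mono) auto
qed

text \<open>The left-hand side of the equation of the ladder as a function of the value \<open>y\<close> of the
  ladder, with the modulus of zeta in place of that of Hardy's function.\<close>

definition smoothed :: "real \<Rightarrow> real \<Rightarrow> real" where
  "smoothed a y = integral {0..a * y * ln y} (\<lambda>t. zeta_sq t * exp (- (2 / y) * t))"

definition smoothed_deriv :: "real \<Rightarrow> real \<Rightarrow> real" where
  "smoothed_deriv a y = 2 / y\<^sup>2 * integral {0..a * y * ln y} (\<lambda>t. t * exp (- (2 / y) * t) * zeta_sq t)
     + zeta_sq (a * y * ln y) * exp (- (2 / y) * (a * y * ln y)) * (a * (ln y + 1))"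

text \<open>The variable \<open>y\<close> enters through the weight and through the upper limit; the two partial
  derivatives are combined by the chain rule along the curve \<open>(y, a * y * ln y)\<close>.\<close>

lemma smoothed_has_derivative:
  assumes a: "0 < a" and y: "1 < y"
  shows "(smoothed a has_real_derivative smoothed_deriv a y) (at y)"
proof -
  let ?f = "\<lambda>x t. zeta_sq t * exp (- (2 / x) * t)"
  define J where "J = (\<lambda>x m. integral {0..m} (?f x))"
  define m where "m = a * y * ln y"
  have m: "0 < m" using a y by (simp add: m_def)
  let ?X = "{0<..} :: real set"
  have "(y, m) \<in> ?X \<times> ?X" using y m by auto
  let ?d = "integral {0..m} (\<lambda>t. zeta_sq t * exp (- (2 / y) * t) * (2 * t / y\<^sup>2))"
  have dx: "((\<lambda>x. J x m) has_real_derivative ?d) (at y within ?X)"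
    unfolding J_def cbox_interval[symmetric]
  proof (rule leibniz_rule_field_derivative)
    show "((\<lambda>x. ?f x t) has_real_derivative zeta_sq t * exp (- (2 / x) * t) * (2 * t / x\<^sup>2)) (at x within ?X)"
      if "x \<in> ?X" for x t
      using that by (auto intro!: derivative_eq_intros simp: power2_eq_square)
    show "?f x integrable_on cbox 0 m" if "x \<in> ?X" for x
      using that by (simp, intro integrable_continuous_real continuous_intros) auto
    have "continuous_on (?X \<times> cbox 0 m) (\<lambda>x. zeta (Complex (1/2) (snd x)))"
      by (rule continuous_on_compose2[OF continuous_on_zeta[of UNIV]]) (auto intro!: continuous_intros)
    then show "continuous_on (?X \<times> cbox 0 m) (\<lambda>(x, t). zeta_sq t * exp (- (2 / x) * t) * (2 * t / x\<^sup>2))"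
      unfolding case_prod_beta by (intro continuous_intros) auto
  qed (use y in auto)
  have dm: "((\<lambda>m. J x m) has_real_derivative ?f x k) (at k within ?X)" if "x \<in> ?X" "k \<in> ?X" for x k
  proof -
    have "((\<lambda>m. J x m) has_real_derivative ?f x k) (at k within {0..k + 1})"
      unfolding J_def using that by (intro integral_has_real_derivative continuous_intros) auto
    moreover have "at k within {0..k + 1} = at k"
      using that by (intro at_within_interior) auto
    ultimately show ?thesis by (metis has_field_derivative_at_within)
  qed
  have "((\<lambda>(x, m). J x m) has_derivative (\<lambda>(tx, tm). ?d * tx + blinfun_scaleR_left (?f y m) tm)) (at (y, m) within ?X \<times> ?X)"
  proof (rule has_derivative_partialsI)
    show "((\<lambda>x. J x m) has_derivative (\<lambda>tx. ?d * tx)) (at y within ?X)"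
      using dx by (simp only: has_field_derivative_def)
    show "((\<lambda>m. J x m) has_derivative blinfun_apply (blinfun_scaleR_left (?f x k))) (at k within ?X)"
      if "x \<in> ?X" "k \<in> ?X" for x k
    proof -
      have "blinfun_apply (blinfun_scaleR_left (?f x k)) = (*) (?f x k)"
        by (simp add: fun_eq_iff mult.commute)
      then show ?thesis using dm[OF that] by (simp only: has_field_derivative_def)
    qed
    have "continuous_on (?X \<times> ?X) (\<lambda>x. zeta (Complex (1/2) (snd x)))"
      by (rule continuous_on_compose2[OF continuous_on_zeta[of UNIV]]) (auto intro!: continuous_intros)
    then have "continuous_on (?X \<times> ?X) (\<lambda>x. blinfun_scaleR_left (?f (fst x) (snd x)) :: real \<Rightarrow>\<^sub>L real)"
      by (intro bounded_linear.continuous_on[OF bounded_linear_blinfun_scaleR_left] continuous_intros) auto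
    then show "continuous (at (y, m) within ?X \<times> ?X) (\<lambda>(x, m). blinfun_scaleR_left (?f x m) :: real \<Rightarrow>\<^sub>L real)"
      using \<open>(y, m) \<in> ?X \<times> ?X\<close> unfolding continuous_on_eq_continuous_within case_prod_beta by blast
  qed (use m in auto)
  moreover have "at (y, m) within ?X \<times> ?X = at (y, m)"
    using y m by (intro at_within_open open_Times) auto
  ultimately have J: "((\<lambda>(x, m). J x m) has_derivative (\<lambda>(tx, tm). ?d * tx + ?f y m * tm)) (at (y, m))"
    by (simp add: mult.commute)
  have "((\<lambda>x. (x, a * x * ln x)) has_derivative (\<lambda>h. (h, (a * (ln y + 1)) * h))) (at y)"
  proof (intro has_derivative_Pair has_derivative_ident)
    have "((\<lambda>x. a * x * ln x) has_real_derivative a * (ln y + 1)) (at y)"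
      using y by (auto intro!: derivative_eq_intros simp: algebra_simps)
    then show "((\<lambda>x. a * x * ln x) has_derivative (\<lambda>h. (a * (ln y + 1)) * h)) (at y)"
      by (simp add: has_field_derivative_def)
  qed
  from has_derivative_compose[OF this, of "\<lambda>(x, m). J x m" "\<lambda>(tx, tm). ?d * tx + ?f y m * tm"] J
  have "((\<lambda>x. J x (a * x * ln x)) has_derivative (\<lambda>h. ?d * h + ?f y m * ((a * (ln y + 1)) * h))) (at y)"
    by (simp add: m_def)
  moreover have "?d = 2 / y\<^sup>2 * integral {0..m} (\<lambda>t. t * exp (- (2 / y) * t) * zeta_sq t)"
    unfolding integral_mult_right[symmetric] by (intro integral_cong) (simp add: mult_ac)
  moreover have "(\<lambda>h. d * h + F * (b * h)) = (*) (e + F * b)" if "d = e" for d e F b :: real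
    using that by (simp add: fun_eq_iff algebra_simps)
  ultimately show ?thesis
    unfolding has_field_derivative_def smoothed_def[abs_def] smoothed_deriv_def J_def m_def[symmetric]
    by (simp only:)
qed

text \<open>With \<open>T = a * y * ln y\<close> the exponential \<open>exp (- T / y)\<close> is at most \<open>y powr (- 7)\<close>, against
  powers of \<open>ln y\<close>.  The bounds are monotone in \<open>a\<close>, which makes the threshold uniform in \<open>a\<close>.\<close>

lemma cutoff_eventually:
  "\<forall>\<^sub>F y in at_top. \<forall>a\<in>{7..8}. cutoff y (a * y * ln y)"
proof -
  have "\<forall>\<^sub>F y in at_top. exp (- (7 * ln y)) * (2 + 2 * (8 * ln y) + (8 * ln y)\<^sup>2) \<le> 1 / (y :: real)"
    by real_asymp
  moreover have "\<forall>\<^sub>F y in at_top. (1 :: real) \<le> y" by (rule eventually_ge_at_top)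
  ultimately show ?thesis
  proof eventually_elim
    case (elim y)
    show ?case
    proof
      fix a :: real assume a: "a \<in> {7..8}"
      have l: "0 \<le> ln y" using elim by simp
      have al: "7 * ln y \<le> a * ln y" "a * ln y \<le> 8 * ln y" "0 \<le> a * ln y"
        using a l mult_right_mono[of 7 a "ln y"] mult_right_mono[of a 8 "ln y"] by auto
      have "exp (- (a * ln y)) * (2 + 2 * (a * ln y) + (a * ln y)\<^sup>2)
          \<le> exp (- (7 * ln y)) * (2 + 2 * (8 * ln y) + (8 * ln y)\<^sup>2)"
        using a l al by (intro mult_mono add_mono power_mono) auto
      with elim(1) have "exp (- (a * ln y)) * (2 + 2 * (a * ln y) + (a * ln y)\<^sup>2) \<le> 1 / y" by linarith
      moreover have "a * y * ln y / y = a * ln y" "- (a * y * ln y) / y = - (a * ln y)"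
        using elim by (auto simp: field_simps)
      ultimately show "cutoff y (a * y * ln y)"
        unfolding cutoff_def using elim al by (auto simp: zero_le_mult_iff)
    qed
  qed
qed

lemma boundary_term_eventually:
  "\<forall>\<^sub>F y in at_top. \<forall>a\<in>{7..8}.
     zeta_sq (a * y * ln y) * exp (- (2 / y) * (a * y * ln y)) * (a * (ln y + 1)) \<le> 1"
proof -
  have "\<forall>\<^sub>F y in at_top. (4 + 4 * (8 * y * ln y))\<^sup>2 * exp (- (14 * ln y)) * (8 * (ln y + 1)) \<le> (1 :: real)"
    by real_asymp
  moreover have "\<forall>\<^sub>F y in at_top. (1 :: real) \<le> y" by (rule eventually_ge_at_top)
  ultimately show ?thesis
  proof eventually_elim
    case (elim y)
    show ?case
    proof
      fix a :: real assume a: "a \<in> {7..8}"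
      have l: "0 \<le> ln y" using elim by simp
      have ayl: "0 \<le> a * y * ln y" "a * y * ln y \<le> 8 * y * ln y"
        using a l elim by (auto intro!: mult_right_mono mult_nonneg_nonneg)
      have al: "7 * ln y \<le> a * ln y" using a l by (auto intro: mult_right_mono)
      have "zeta_sq (a * y * ln y) \<le> (4 + 4 * (8 * y * ln y))\<^sup>2"
        using ayl by (intro order.trans[OF zeta_sq_le] power_mono) auto
      moreover have "exp (- (2 / y) * (a * y * ln y)) \<le> exp (- (14 * ln y))"
        using al elim by simp
      moreover have "a * (ln y + 1) \<le> 8 * (ln y + 1)" using a l by (intro mult_right_mono) auto
      ultimately have "zeta_sq (a * y * ln y) * exp (- (2 / y) * (a * y * ln y)) * (a * (ln y + 1)) \<le>
         (4 + 4 * (8 * y * ln y))\<^sup>2 * exp (- (14 * ln y)) * (8 * (ln y + 1))"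
        using a l by (intro mult_mono) auto
      with elim(1) show "zeta_sq (a * y * ln y) * exp (- (2 / y) * (a * y * ln y)) * (a * (ln y + 1)) \<le> 1" by linarith
    qed
  qed
qed

text \<open>The weighted second moment divided by \<open>y\<^sup>2 / 2\<close> is \<open>ln y / 2 + O(1)\<close>, and the term from
  the moving upper limit is bounded.\<close>

lemma smoothed_deriv_approx:
  "\<forall>\<^sub>F y in at_top. \<forall>a\<in>{7..8}. \<bar>smoothed_deriv a y - ln y / 2\<bar> \<le> 1101"
  using cutoff_eventually boundary_term_eventually eventually_ge_at_top[of "1 :: real"]
proof eventually_elim
  case (elim y)
  show ?case
  proof
    fix a :: real assume a: "a \<in> {7..8}"
    let ?W = "integral {0..a * y * ln y} (\<lambda>t. t * exp (- (2 / y) * t) * zeta_sq t)"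
    let ?b = "zeta_sq (a * y * ln y) * exp (- (2 / y) * (a * y * ln y)) * (a * (ln y + 1))"
    have W: "\<bar>?W - y\<^sup>2 * ln y / 4\<bar> \<le> 550 * y\<^sup>2"
      using elim a by (intro weighted_second_moment) auto
    have "2 / y\<^sup>2 * ?W - ln y / 2 = 2 / y\<^sup>2 * (?W - y\<^sup>2 * ln y / 4)"
      using elim by (simp add: field_simps)
    then have "\<bar>2 / y\<^sup>2 * ?W - ln y / 2\<bar> = 2 / y\<^sup>2 * \<bar>?W - y\<^sup>2 * ln y / 4\<bar>"
      by (simp only: abs_mult) simp
    also have "\<dots> \<le> 2 / y\<^sup>2 * (550 * y\<^sup>2)" using W by (intro mult_left_mono) auto
    also have "\<dots> = 1100" using elim by simp
    finally have "\<bar>2 / y\<^sup>2 * ?W - ln y / 2\<bar> \<le> 1100" .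
    moreover have "0 \<le> ?b" using a elim by auto
    moreover have "?b \<le> 1" using elim a by blast
    ultimately show "\<bar>smoothed_deriv a y - ln y / 2\<bar> \<le> 1101"
      unfolding smoothed_deriv_def by linarith
  qed
qed

text \<open>The ladder is of the order of \<open>T\<close> up to powers of \<open>ln T\<close>.  If \<open>T\<close> exceeded the upper
  limit \<open>a * \<phi> T * ln (\<phi> T)\<close>, then the exponentially damped integral over a shorter range
  would equal the undamped one over a longer range; this bounds \<open>\<phi> T\<close> from below.  For the upper
  bound, the weight at scale \<open>T\<close> is at least \<open>exp (- 2)\<close> on \<open>[0, T]\<close>, so the undamped integral
  is at most \<open>exp 2\<close> times the smoothed one at \<open>T\<close>, while the smoothed integral grows at least
  linearly.\<close>

lemma ladder_log_bounds:
  assumes a: "a \<in> {7..8}" and lad: "jacobs_ladder (\<lambda>y. a * y * ln y) \<phi>"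
  shows "\<forall>\<^sub>F T in at_top. ln T - 3 * ln (ln T) \<le> ln (\<phi> T) \<and> ln (\<phi> T) \<le> ln T + 2 * ln (ln T)"
proof -
  have lim: "filterlim \<phi> at_top at_top" using lad by (simp add: jacobs_ladder_def)
  obtain T1 where T1: "0 \<le> T1"
    "\<And>T. T1 \<le> T \<Longrightarrow> smoothed a (\<phi> T) = integral {0..T} zeta_sq"
    using lad unfolding jacobs_ladder_def cmod_hardy_Z smoothed_def by blast
  \<comment> \<open>For \<open>ln y \<ge> 2204\<close> the derivative lies between \<open>1\<close> and \<open>ln y\<close>, and \<open>ln y / 4 > 550\<close>.\<close>
  have "\<forall>\<^sub>F y in at_top. \<bar>smoothed_deriv a y - ln y / 2\<bar> \<le> 1101 \<and>
      cutoff y (a * y * ln y) \<and> exp 2204 \<le> y"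
    using smoothed_deriv_approx cutoff_eventually eventually_ge_at_top[of "exp 2204 :: real"]
    by eventually_elim (use a in blast)
  then obtain Y where "\<forall>y\<ge>Y. \<bar>smoothed_deriv a y - ln y / 2\<bar> \<le> 1101 \<and>
      cutoff y (a * y * ln y) \<and> exp 2204 \<le> y"
    unfolding eventually_at_top_linorder by blast
  then have Y: "\<And>y. Y \<le> y \<Longrightarrow> \<bar>smoothed_deriv a y - ln y / 2\<bar> \<le> 1101"
      "\<And>y. Y \<le> y \<Longrightarrow> cutoff y (a * y * ln y)"
      "\<And>y. Y \<le> y \<Longrightarrow> exp 2204 \<le> y"
    by blast+
  have lnY: "2204 \<le> ln y" "1 < y" if "Y \<le> y" for y
  proof -
    show "1 < y" using Y(3)[OF that] one_less_exp_iff[of 2204] by linarith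
    then show "2204 \<le> ln y" using Y(3)[OF that] by (simp add: ln_ge_iff)
  qed
  have contZ: "continuous_on X zeta_sq" for X by (intro continuous_intros)
  have intZ: "zeta_sq integrable_on {u..v}" for u v by (intro integrable_continuous_real contZ)
  have inte: "(\<lambda>t. zeta_sq t * exp (- (2 / y) * t)) integrable_on {u..v}" if "1 < y" for u v y
    using that by (intro integrable_continuous_real continuous_intros) auto
  have mvt: "\<exists>z. Y < z \<and> z < y \<and> smoothed a y - smoothed a Y = (y - Y) * smoothed_deriv a z" if "Y < y" for y
    by (rule MVT2[OF that]) (use a lnY(2) in \<open>auto intro!: smoothed_has_derivative\<close>)
  have lower: "y - Y \<le> smoothed a y" if Yy: "Y \<le> y" for y
  proof (cases "Y = y")
    case True
    then show ?thesis unfolding smoothed_def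
      using lnY(2)[OF that] True by (intro order.trans[OF _ integral_nonneg] inte) auto
  next
    case False
    then obtain z where z: "Y < z" "z < y" "smoothed a y - smoothed a Y = (y - Y) * smoothed_deriv a z"
      using mvt[of y] Yy by auto
    have "1 \<le> smoothed_deriv a z" using Y(1)[of z] lnY(1)[of z] z(1) by linarith
    then have "(y - Y) * 1 \<le> (y - Y) * smoothed_deriv a z" using that by (intro mult_left_mono) auto
    moreover have "0 \<le> smoothed a Y" unfolding smoothed_def
      using lnY(2)[of Y] by (intro integral_nonneg inte) auto
    ultimately show ?thesis using z(3) by simp
  qed
  have upper: "smoothed a y \<le> smoothed a Y + y * ln y" if Yy: "Y \<le> y" for y
  proof (cases "Y = y")
    case True
    then show ?thesis using lnY[OF that] by (simp add: zero_le_mult_iff)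
  next
    case False
    then obtain z where z: "Y < z" "z < y" "smoothed a y - smoothed a Y = (y - Y) * smoothed_deriv a z"
      using mvt[of y] Yy by auto
    have "smoothed_deriv a z \<le> ln z" using Y(1)[of z] lnY(1)[of z] z(1) by linarith
    also have "\<dots> \<le> ln y" using z lnY(2)[of Y] by simp
    finally have "(y - Y) * smoothed_deriv a z \<le> (y - Y) * ln y" using that by (intro mult_left_mono) auto
    also have "\<dots> \<le> y * ln y" using lnY[OF that] lnY(2)[of Y] by (intro mult_right_mono) auto
    finally show ?thesis using z(3) by simp
  qed
  have le_mu: "T \<le> a * \<phi> T * ln (\<phi> T)" if T: "T1 \<le> T" and phi: "Y \<le> \<phi> T" for T
  proof (rule ccontr)
    define y where "y = \<phi> T"
    define m where "m = a * y * ln y"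
    assume "\<not> ?thesis"
    then have m: "m < T" by (simp add: m_def y_def)
    have y: "1 < y" "2204 \<le> ln y" "Y \<le> y" using lnY phi by (auto simp: y_def)
    let ?W = "integral {0..m} (\<lambda>t. t * exp (- (2 / y) * t) * zeta_sq t)"
    have "\<bar>?W - y\<^sup>2 * ln y / 4\<bar> \<le> 550 * y\<^sup>2"
      unfolding m_def using Y(2)[OF y(3)] by (rule weighted_second_moment)
    moreover have "y\<^sup>2 * 2204 / 4 \<le> y\<^sup>2 * ln y / 4" using y by (intro divide_right_mono mult_left_mono) auto
    moreover have "0 < y\<^sup>2" using y by simp
    ultimately have W: "0 < ?W" by linarith
    have i: "(\<lambda>t. t * exp (- (2 / y) * t) * zeta_sq t) integrable_on {0..m}"
      using y by (intro integrable_continuous_real continuous_intros) auto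
    have "2 / y * ?W + smoothed a y = integral {0..m} (\<lambda>t. 2 / y * (t * exp (- (2 / y) * t) * zeta_sq t) + zeta_sq t * exp (- (2 / y) * t))"
      unfolding smoothed_def m_def[symmetric]
      by (intro integral_unique[symmetric] has_integral_add has_integral_mult_right
        integrable_integral i inte y)
    also have "\<dots> \<le> integral {0..m} zeta_sq"
    proof (rule integral_le)
      fix t assume "t \<in> {0..m}"
      have "exp (- (2 / y) * t) * (1 + 2 / y * t) \<le> exp (- (2 / y) * t) * exp (2 / y * t)"
        by (intro mult_left_mono exp_ge_add_one_self) auto
      also have "\<dots> = 1" by (simp add: exp_add[symmetric])
      finally have "zeta_sq t * (exp (- (2 / y) * t) * (1 + 2 / y * t)) \<le> zeta_sq t * 1" by (intro mult_left_mono) auto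
      then show "2 / y * (t * exp (- (2 / y) * t) * zeta_sq t) + zeta_sq t * exp (- (2 / y) * t) \<le> zeta_sq t"
        by (simp add: algebra_simps)
    next
      show "(\<lambda>t. 2 / y * (t * exp (- (2 / y) * t) * zeta_sq t) + zeta_sq t * exp (- (2 / y) * t)) integrable_on {0..m}"
        using y by (intro integrable_continuous_real continuous_intros) auto
    qed (rule intZ)
    also have "\<dots> \<le> integral {0..T} zeta_sq"
      using m by (intro integral_subset_le intZ) auto
    also have "\<dots> = smoothed a y" using T1(2)[OF T] by (simp add: y_def)
    finally have "2 / y * ?W \<le> 0" by simp
    then show False using W y by (simp add: mult_le_0_iff divide_le_0_iff)
  qed
  have le_T: "\<phi> T \<le> Y + exp 2 * (smoothed a Y + T * ln T)" if T: "T1 \<le> T" "Y \<le> T" and phi: "Y \<le> \<phi> T" for T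
  proof -
    have T': "1 < T" "2204 \<le> ln T" using lnY[OF T(2)] by auto
    have Tm: "T \<le> a * T * ln T"
    proof -
      have "1 * T * 1 \<le> a * T * ln T" using a T' by (intro mult_mono) auto
      then show ?thesis by simp
    qed
    have "\<phi> T - Y \<le> integral {0..T} zeta_sq" using lower[OF phi] T1(2)[OF T(1)] by simp
    also have "\<dots> \<le> integral {0..T} (\<lambda>t. exp 2 * (zeta_sq t * exp (- (2 / T) * t)))"
    proof (rule integral_le[OF intZ])
      show "(\<lambda>t. exp 2 * (zeta_sq t * exp (- (2 / T) * t))) integrable_on {0..T}"
        by (intro integrable_on_mult_right inte T')
      fix t assume t: "t \<in> {0..T}"
      have "1 \<le> exp (2 - 2 / T * t)" using t T' by (simp add: field_simps)
      also have "\<dots> = exp 2 * exp (- (2 / T) * t)" by (simp add: exp_add[symmetric])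
      finally have "zeta_sq t * 1 \<le> zeta_sq t * (exp 2 * exp (- (2 / T) * t))" by (intro mult_left_mono) auto
      then show "zeta_sq t \<le> exp 2 * (zeta_sq t * exp (- (2 / T) * t))" by (simp add: mult_ac)
    qed
    also have "\<dots> = exp 2 * integral {0..T} (\<lambda>t. zeta_sq t * exp (- (2 / T) * t))" by simp
    also have "\<dots> \<le> exp 2 * smoothed a T"
      unfolding smoothed_def using Tm T' by (intro mult_left_mono integral_subset_le inte) auto
    also have "\<dots> \<le> exp 2 * (smoothed a Y + T * ln T)"
      using upper[OF T(2)] by (intro mult_left_mono) auto
    finally show ?thesis by simp
  qed
  define c where "c = smoothed a Y"
  have "\<forall>\<^sub>F T in at_top. Y + exp 2 * (c + T * ln T) \<le> T * (ln T)\<^sup>2" by real_asymp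
  moreover have "\<forall>\<^sub>F T :: real in at_top. ln T + 2 * ln (ln T) \<le> 2 * ln T" by real_asymp
  moreover have "\<forall>\<^sub>F T :: real in at_top. ln 8 + ln (2 * ln T) \<le> 3 * ln (ln T)" by real_asymp
  moreover have "\<forall>\<^sub>F T in at_top. max T1 (max Y 3) \<le> T" by (rule eventually_ge_at_top)
  moreover have "\<forall>\<^sub>F T in at_top. Y \<le> \<phi> T" using lim by (simp add: filterlim_at_top)
  ultimately show ?thesis
  proof eventually_elim
    case (elim T)
    have T: "T1 \<le> T" "Y \<le> T" "3 \<le> T" using elim(4) by auto
    have T': "1 < T" "2204 \<le> ln T" using lnY[OF T(2)] by auto
    have y: "1 < \<phi> T" "2204 \<le> ln (\<phi> T)" using lnY[OF elim(5)] by auto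
    have "\<phi> T \<le> T * (ln T)\<^sup>2" using le_T[OF T(1,2) elim(5)] elim(1) unfolding c_def by linarith
    then have "ln (\<phi> T) \<le> ln (T * (ln T)\<^sup>2)" using y T' by (subst ln_le_cancel_iff) auto
    also have "\<dots> = ln T + 2 * ln (ln T)" using T' by (simp add: ln_mult ln_realpow)
    finally have up: "ln (\<phi> T) \<le> ln T + 2 * ln (ln T)" .
    have "a * \<phi> T * ln (\<phi> T) \<le> 8 * \<phi> T * (2 * ln T)"
      using a y up elim(2) by (intro mult_mono) auto
    with le_mu[OF T(1) elim(5)] have "T \<le> 8 * \<phi> T * (2 * ln T)" by linarith
    then have "ln T \<le> ln (8 * \<phi> T * (2 * ln T))" using T' y by (subst ln_le_cancel_iff) auto
    also have "\<dots> = ln 8 + ln (\<phi> T) + ln (2 * ln T)"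
      using T' y ln_mult[of "8 * \<phi> T" "2 * ln T"] ln_mult[of 8 "\<phi> T"] by simp
    finally show ?case using up elim(3) by linarith
  qed
qed

theorem theorem1:
  "\<exists>C::real. \<forall>a\<in>{7..8::real}. \<forall>\<phi> :: real \<Rightarrow> real.
     jacobs_ladder (\<lambda>y. a * y * ln y) \<phi> \<longrightarrow>
     (\<exists>T\<^sub>0::real. \<forall>T\<ge>T\<^sub>0. \<forall>U\<in>{0<..T / ln T}.
        \<exists>r::real. \<bar>r\<bar> \<le> C * (ln (ln T) / ln T) \<and>
          integral {T..T + U} (\<lambda>t. (cmod (hardy_Z t))\<^sup>2) =
            (1 + r) * (U * ln T * tan (chord_angle \<phi> T U)))"
\<comment> \<open>The logarithms of \<open>\<phi>\<close> contribute 3; the bounded terms are absorbed by one further \<open>ln (ln T)\<close>.\<close>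
proof (rule exI[of _ 4], intro ballI allI impI)
  fix a :: real and \<phi> :: "real \<Rightarrow> real"
  assume a: "a \<in> {7..8}" and lad: "jacobs_ladder (\<lambda>y. a * y * ln y) \<phi>"
  have lim: "filterlim \<phi> at_top at_top" using lad by (simp add: jacobs_ladder_def)
  obtain T1 where T1: "0 \<le> T1" "strict_mono_on {T1..} \<phi>"
    "\<And>T. T1 \<le> T \<Longrightarrow> smoothed a (\<phi> T) = integral {0..T} zeta_sq"
    using lad unfolding jacobs_ladder_def cmod_hardy_Z smoothed_def by blast
  have "\<forall>\<^sub>F y in at_top. \<bar>smoothed_deriv a y - ln y / 2\<bar> \<le> 1101 \<and> 2 \<le> y"
    using smoothed_deriv_approx eventually_ge_at_top[of "2 :: real"]
    by eventually_elim (use a in blast)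
  then obtain Y where Y: "\<And>y. Y \<le> y \<Longrightarrow> \<bar>smoothed_deriv a y - ln y / 2\<bar> \<le> 1101 \<and> 2 \<le> y"
    unfolding eventually_at_top_linorder by blast
  have ev: "\<forall>\<^sub>F T in at_top. (ln T - 3 * ln (ln T) \<le> ln (\<phi> T) \<and> ln (\<phi> T) \<le> ln T + 2 * ln (ln T))
      \<and> Y \<le> \<phi> T \<and> 2202 \<le> ln (ln T) \<and> ln (2 * T) + 2 * ln (ln (2 * T)) \<le> ln T + 3 * ln (ln T)
      \<and> max T1 3 \<le> T \<and> 1 \<le> ln T"
  proof -
    have "\<forall>\<^sub>F T in at_top. Y \<le> \<phi> T" using lim by (simp add: filterlim_at_top)
    moreover have "\<forall>\<^sub>F T in at_top. (2202 :: real) \<le> ln (ln T)"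
      "\<forall>\<^sub>F T :: real in at_top. ln (2 * T) + 2 * ln (ln (2 * T)) \<le> ln T + 3 * ln (ln T)"
      "\<forall>\<^sub>F T in at_top. (1 :: real) \<le> ln T" by real_asymp+
    ultimately show ?thesis
      using ladder_log_bounds[OF a lad] eventually_ge_at_top[of "max T1 3"]
      by eventually_elim simp
  qed
  then obtain T0 where T0: "\<And>T. T0 \<le> T \<Longrightarrow> (ln T - 3 * ln (ln T) \<le> ln (\<phi> T) \<and> ln (\<phi> T) \<le> ln T + 2 * ln (ln T))
      \<and> Y \<le> \<phi> T \<and> 2202 \<le> ln (ln T) \<and> ln (2 * T) + 2 * ln (ln (2 * T)) \<le> ln T + 3 * ln (ln T)
      \<and> max T1 3 \<le> T \<and> 1 \<le> ln T"
    unfolding eventually_at_top_linorder by blast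
  show "\<exists>T\<^sub>0. \<forall>T\<ge>T\<^sub>0. \<forall>U\<in>{0<..T / ln T}. \<exists>r. \<bar>r\<bar> \<le> 4 * (ln (ln T) / ln T) \<and>
      integral {T..T + U} (\<lambda>t. (cmod (hardy_Z t))\<^sup>2) = (1 + r) * (U * ln T * tan (chord_angle \<phi> T U))"
  proof (rule exI[of _ T0], intro allI impI ballI)
    fix T U assume T: "T0 \<le> T" and U: "U \<in> {0<..T / ln T}"
    note t = T0[OF T]
    have T3: "3 \<le> T" "T1 \<le> T" "0 < U" using t U by auto
    have "T / ln T \<le> T / 1" using t T3 by (intro divide_left_mono) auto
    then have U2: "T + U \<le> 2 * T" using U by auto
    note tu = T0[of "T + U"]
    have mono: "\<phi> T < \<phi> (T + U)"
      using T1(2) T3 by (auto intro: strict_mono_onD)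
    obtain z where z: "\<phi> T < z" "z < \<phi> (T + U)"
      "smoothed a (\<phi> (T + U)) - smoothed a (\<phi> T) = (\<phi> (T + U) - \<phi> T) * smoothed_deriv a z"
    proof -
      have "\<exists>z. \<phi> T < z \<and> z < \<phi> (T + U) \<and>
         smoothed a (\<phi> (T + U)) - smoothed a (\<phi> T) = (\<phi> (T + U) - \<phi> T) * smoothed_deriv a z"
      proof (rule MVT2[OF mono])
        fix x assume "\<phi> T \<le> x"
        then have "1 < x" using Y[of x] t by linarith
        then show "(smoothed a has_real_derivative smoothed_deriv a x) (at x)"
          using a by (intro smoothed_has_derivative) auto
      qed
      then show ?thesis using that by blast
    qed
    \<comment> \<open>The tangent of the chord angle is \<open>(\<phi> (T + U) - \<phi> T) / (2 * U)\<close>, whence the factor 2.\<close>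
    define r where "r = (2 * smoothed_deriv a z - ln T) / ln T"
    have zY: "Y \<le> z" using z t by linarith
    have z0: "0 < \<phi> T" using Y[of "\<phi> T"] t by linarith
    have "ln (\<phi> T) \<le> ln z" "ln z \<le> ln (\<phi> (T + U))" using z z0 by auto
    moreover have "ln (T + U) \<le> ln (2 * T)" using U2 T3 by simp
    moreover have "ln (ln (T + U)) \<le> ln (ln (2 * T))"
      using \<open>ln (T + U) \<le> ln (2 * T)\<close> T T3 tu by (subst ln_le_cancel_iff) auto
    ultimately have "\<bar>2 * smoothed_deriv a z - ln T\<bar> \<le> 4 * ln (ln T)"
      using t tu T T3 Y[OF zY] by linarith
    then have r: "\<bar>r\<bar> \<le> 4 * (ln (ln T) / ln T)"
      using t by (simp add: r_def divide_right_mono)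
    have "integral {0..T} zeta_sq + integral {T..T + U} zeta_sq = integral {0..T + U} zeta_sq"
      using T3 by (intro Henstock_Kurzweil_Integration.integral_combine integrable_continuous_real continuous_intros) auto
    then have "integral {T..T + U} zeta_sq = (\<phi> (T + U) - \<phi> T) * smoothed_deriv a z"
      using z(3) T1(3)[of T] T1(3)[of "T + U"] T3 by simp
    also have "\<dots> = (1 + r) * (U * ln T * ((\<phi> (T + U) - \<phi> T) / (2 * U)))"
    proof -
      have "1 + r = 2 * smoothed_deriv a z / ln T" using t by (simp add: r_def field_simps)
      then show ?thesis using t T3 by simp
    qed
    finally show "\<exists>r. \<bar>r\<bar> \<le> 4 * (ln (ln T) / ln T) \<and>
      integral {T..T + U} (\<lambda>t. (cmod (hardy_Z t))\<^sup>2) = (1 + r) * (U * ln T * tan (chord_angle \<phi> T U))"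
      using r unfolding cmod_hardy_Z chord_angle_def tan_arctan by blast
  qed
qed

end
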